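(* Let $A=\{0,1\}$ and let $(X_t)_{t\in\mathbb Z}$ be an MTD model of order $d$ with set of relevant lags $\Lambda$, satisfying Assumptions 4 and 5 (stated in the context, with constants $\Gamma_1$ and $\Gamma_2$). Then $$\min_{S\subsetneq\Lambda}\Big(\max_{j\in\Lambda\setminus S}\bar\nu_{j,S}-\max_{j\in\Lambda^c}\bar\nu_{j,S}\Big)\ge2(\Gamma_1-\Gamma_2)\,p_{min}^2\,\delta_{min},$$ where $\Lambda^c=\{-d,\dots,-1\}\setminus\Lambda$. In particular, if $\Gamma_1>\Gamma_2$ and $\hat S_m$ denotes the candidate set constructed at the end of the FS step (defined in the context) with parameter $\ell\ge|\Lambda|$, then $\Lambda\subseteq\hat S_m$ whenever the event $G_m(\ell,\xi)$ holds, where $$0<\xi<(\Gamma_1-\Gamma_2)\,p_{min}^2\,\delta_{min}.$$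
   Context: For $S\subset\mathbb Z$, $A^S$ is the set of strings $x_S=(x_j)_{j\in S}$ and $X_S=(X_j)_{j\in S}$. $d_{TV}(\mu,\nu)=\frac12\sum_{a\in A}|\mu(a)-\nu(a)|$. MTD model of order $d\ge1$: a stationary $A$-valued Markov chain $(X_t)_{t\in\mathbb Z}$ of order $d$ with transition probabilities $p(a|x_{-d:-1})=\lambda_0p_0(a)+\sum_{j=-d}^{-1}\lambda_jp_j(a|x_j)$, where $\lambda_{-d},\dots,\lambda_0\in[0,1]$ sum to $1$ and $p_0(\cdot)$, $p_j(\cdot|b)$ are probability measures on $A$. $\delta_j=\lambda_j\max_{b,c\in A}d_{TV}(p_j(\cdot|b),p_j(\cdot|c))$, $\Lambda=\{j\in\{-d,\dots,-1\}:\delta_j>0\}$, $\delta_{min}=\min_{j\in\Lambda}\delta_j$, $m_j(b)=\sum_{a\in A}a\,p_j(a|b)$. The transition probability depends on the past only through $x_\Lambda$ and is written $p(a|x_\Lambda)$; $p_{min}=\min_{a,x_\Lambda}p(a|x_\Lambda)$. $\mathbb P_{x_S},\mathbb E_{x_S}$ denote probability and expectation conditionally on $X_S=x_S$ (unconditional if $S=\emptyset$); $\mathbb P_{x_S}(\cdot|X_k=b)$, $\mathbb E_{x_S}(\cdot|X_k=b)$ are conditional on $X_S=x_S$ and $X_k=b$. For $k\notin S$, $$\bar\nu_{k,S}=\mathbb E(\nu_{k,S}(X_S)),\quad \nu_{k,S}(x_S)=\sum_{b,c\in A}\mathbb P_{x_S}(X_k=b)\mathbb P_{x_S}(X_k=c)\,d_{TV}\big(\mathbb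 P_{x_S}(X_0\in\cdot|X_k=b),\mathbb P_{x_S}(X_0\in\cdot|X_k=c)\big).$$ Assumption 4: there exists $\Gamma_1\in(0,1]$ such that for all $S\subseteq\{-d,\dots,-1\}$ with $\Lambda\not\subseteq S$, all $k\in\Lambda\setminus S$ and all $b\ne c$ in $A$ with $|m_k(b)-m_k(c)|>0$, $$\max_{x_S\in A^S}\sum_{j\in\Lambda\setminus(S\cup\{k\})}\frac{\lambda_j|\mathbb E_{x_S}(m_j(X_j)|X_k=b)-\mathbb E_{x_S}(m_j(X_j)|X_k=c)|}{\lambda_k|m_k(b)-m_k(c)|}\le1-\Gamma_1 .$$ Assumption 5: the alphabet is $A=\{0,1\}$ and there exists $\Gamma_2\in(0,1]$ such that for all $S\subset\Lambda$ and all $k\in\{-d,\dots,-1\}\setminus\Lambda$, $$\sum_{j\in\Lambda\setminus S}\max_{x_S\in\{0,1\}^S}|\mathbb P_{x_S}(X_k=1|X_j=1)-\mathbb P_{x_S}(X_k=1|X_j=0)|\le\Gamma_2 .$$ FS step with parameter $0\le\ell\le d$, from the sample $X_{1:m}$, $m>d$: for $S\subseteq\{-d,\dots,-1\}$ let $N_m(x_S,a)=\sum_{t=d+1}^m1\{X_{t+j}=x_j\ \forall j\in S,\ X_t=a\}$, $\bar N_m(x_S)=\sum_aN_m(x_S,a)$, $\hat{\mathbf P}_m(x_S)=\bar N_m(x_S)/(m-d)$. For $k\notin S$ let $\hat{\mathbf P}_m(x_S,b)$ be $\hat{\mathbf P}_m$ of the string on $S\cup\{k\}$ equal to $x_S$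 on $S$ and to $b$ at $k$, and $\hat{\mathbf P}_m(x_S,b,a)$ be $(m-d)^{-1}$ times $N_m$ of that string followed by $a$. Put $$\hat\nu_{m,k,S}=\sum_{x_S\in A^S}\hat{\mathbf P}_m(x_S)\sum_{b,c\in A}\frac{\hat{\mathbf P}_m(x_S,b)\hat{\mathbf P}_m(x_S,c)}{\hat{\mathbf P}_m(x_S)^2}\cdot\frac12\sum_{a\in A}\Big|\frac{\hat{\mathbf P}_m(x_S,b,a)}{\hat{\mathbf P}_m(x_S,b)}-\frac{\hat{\mathbf P}_m(x_S,c,a)}{\hat{\mathbf P}_m(x_S,c)}\Big|$$ (terms in which some denominator vanishes are $0$). Start with $\hat S_m=\emptyset$ and, while $|\hat S_m|<\ell$, add to $\hat S_m$ some $j_*\in\arg\max_{j\in\hat S_m^c}\hat\nu_{m,j,\hat S_m}$ (complement in $\{-d,\dots,-1\}$). $G_m(\ell,\xi)$ is the event that $\max_{j\in S^c}|\bar\nu_{j,S}-\hat\nu_{m,j,S}|\le\xi$ for every $S\subseteq\{-d,\dots,-1\}$ with $|S|\le\ell$.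
   Formalization: The lower bound on the minimum over S is stated for nonempty Λ and only when Γ_2 ≤ Γ_1; for Γ_2 > Γ_1 it can fail (an order-5 binary MTD model with four relevant lags has a gap below the negative right-hand side). The FS-step claim is unchanged. *)

theory Defs
  imports "HOL-Probability.Probability"
begin

(* For finite J; the value 0 on the empty set is the neutral choice, since it is only used
   for nonnegative quantities. *)
definition finite_max :: "'i set \<Rightarrow> ('i \<Rightarrow> real) \<Rightarrow> real" where
  "finite_max J f = (if J = {} then 0 else Max (f ` J))"

definition d_TV :: "real set \<Rightarrow> (real \<Rightarrow> real) \<Rightarrow> (real \<Rightarrow> real) \<Rightarrow> real" where
  "d_TV A \<mu> \<nu> = (1/2) * (\<Sum>a\<in>A. \<bar>\<mu> a - \<nu> a\<bar>)"

definition lags :: "nat \<Rightarrow> int set" where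
  "lags d = {- int d .. -1}"

definition strings :: "real set \<Rightarrow> int set \<Rightarrow> (int \<Rightarrow> real) set" where
  "strings A S = S \<rightarrow>\<^sub>E A"


section \<open>MTD models\<close>

(* The weight lambda_0 is lam 0; p j b is the measure p_j( . | b); only x restricted to
   lags d matters. *)
definition trans_prob ::
  "nat \<Rightarrow> (int \<Rightarrow> real) \<Rightarrow> real pmf \<Rightarrow> (int \<Rightarrow> real \<Rightarrow> real pmf) \<Rightarrow> real \<Rightarrow> (int \<Rightarrow> real) \<Rightarrow> real" where
  "trans_prob d lam p0 p a x = lam 0 * pmf p0 a + (\<Sum>j\<in>lags d. lam j * pmf (p j (x j)) a)"

definition agrees :: "(int \<Rightarrow> 'w \<Rightarrow> real) \<Rightarrow> int set \<Rightarrow> (int \<Rightarrow> real) \<Rightarrow> 'w \<Rightarrow> bool" where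
  "agrees X S x \<omega> \<longleftrightarrow> (\<forall>j\<in>S. X j \<omega> = x j)"

(* Stationarity is equality of all finite-dimensional distributions of the process and its
   shifts.  In the Markov property the past may be longer than d, but the conditional law
   only involves the last d symbols. *)
locale mtd_model = prob_space M
  for M :: "'w measure" +
  fixes A :: "real set" and X :: "int \<Rightarrow> 'w \<Rightarrow> real" and d :: nat
    and lam :: "int \<Rightarrow> real" and p0 :: "real pmf" and p :: "int \<Rightarrow> real \<Rightarrow> real pmf"
  assumes finite_alphabet: "finite A" "A \<noteq> {}"
    and order_pos: "d \<ge> 1"
    and weights: "\<And>j. j \<in> insert 0 (lags d) \<Longrightarrow> lam j \<in> {0..1}"
      "(\<Sum>j\<in>insert 0 (lags d). lam j) = 1"
    and p0_on_alphabet: "set_pmf p0 \<subseteq> A"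
    and p_on_alphabet: "\<And>j b. j \<in> lags d \<Longrightarrow> b \<in> A \<Longrightarrow> set_pmf (p j b) \<subseteq> A"
    and random_variables: "\<And>t. X t \<in> measurable M (count_space A)"
    and stationary: "\<And>T x h. finite T \<Longrightarrow>
      \<P>(\<omega> in M. \<forall>t\<in>T. X (t + h) \<omega> = x t) = \<P>(\<omega> in M. \<forall>t\<in>T. X t \<omega> = x t)"
    and markov: "\<And>t n x a. d \<le> n \<Longrightarrow> a \<in> A \<Longrightarrow>
      \<P>(\<omega> in M. agrees X {t - int n .. t - 1} x \<omega>) > 0 \<Longrightarrow>
      \<P>(\<omega> in M. X t \<omega> = a \<bar> agrees X {t - int n .. t - 1} x \<omega>)
        = trans_prob d lam p0 p a (\<lambda>j. x (t + j))"

definition delta ::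
  "real set \<Rightarrow> (int \<Rightarrow> real) \<Rightarrow> (int \<Rightarrow> real \<Rightarrow> real pmf) \<Rightarrow> int \<Rightarrow> real" where
  "delta A lam p j = lam j * (MAX (b, c)\<in>A \<times> A. d_TV A (pmf (p j b)) (pmf (p j c)))"

definition relevant_lags ::
  "real set \<Rightarrow> nat \<Rightarrow> (int \<Rightarrow> real) \<Rightarrow> (int \<Rightarrow> real \<Rightarrow> real pmf) \<Rightarrow> int set" where
  "relevant_lags A d lam p = {j \<in> lags d. delta A lam p j > 0}"

definition delta_min ::
  "real set \<Rightarrow> nat \<Rightarrow> (int \<Rightarrow> real) \<Rightarrow> (int \<Rightarrow> real \<Rightarrow> real pmf) \<Rightarrow> real" where
  "delta_min A d lam p = (MIN j\<in>relevant_lags A d lam p. delta A lam p j)"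

definition cond_mean :: "real set \<Rightarrow> (int \<Rightarrow> real \<Rightarrow> real pmf) \<Rightarrow> int \<Rightarrow> real \<Rightarrow> real" where
  "cond_mean A p j b = (\<Sum>a\<in>A. a * pmf (p j b) a)"

(* Minimising over complete pasts is the same as minimising over their restrictions to the
   relevant lags, because the transition probability is a function of that restriction. *)
definition p_min ::
  "real set \<Rightarrow> nat \<Rightarrow> (int \<Rightarrow> real) \<Rightarrow> real pmf \<Rightarrow> (int \<Rightarrow> real \<Rightarrow> real pmf) \<Rightarrow> real" where
  "p_min A d lam p0 p = (MIN (a, x)\<in>A \<times> strings A (lags d). trans_prob d lam p0 p a x)"


section \<open>The quantities nu\<close>

(* A conditional probability given a null event is 0 here; it then always occurs multiplied
   by a vanishing conditional probability of X k = b or X k = c. *)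
definition nu ::
  "'w measure \<Rightarrow> real set \<Rightarrow> (int \<Rightarrow> 'w \<Rightarrow> real) \<Rightarrow> int \<Rightarrow> int set \<Rightarrow> (int \<Rightarrow> real) \<Rightarrow> real" where
  "nu M A X k S x = (\<Sum>b\<in>A. \<Sum>c\<in>A.
     \<P>(\<omega> in M. X k \<omega> = b \<bar> agrees X S x \<omega>) * \<P>(\<omega> in M. X k \<omega> = c \<bar> agrees X S x \<omega>) *
     d_TV A (\<lambda>a. \<P>(\<omega> in M. X 0 \<omega> = a \<bar> agrees X S x \<omega> \<and> X k \<omega> = b))
            (\<lambda>a. \<P>(\<omega> in M. X 0 \<omega> = a \<bar> agrees X S x \<omega> \<and> X k \<omega> = c)))"

definition nu_bar ::
  "'w measure \<Rightarrow> real set \<Rightarrow> (int \<Rightarrow> 'w \<Rightarrow> real) \<Rightarrow> int \<Rightarrow> int set \<Rightarrow> real" where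
  "nu_bar M A X k S = (\<integral>\<omega>. nu M A X k S (\<lambda>j. X j \<omega>) \<partial>M)"


section \<open>Weak dependence assumptions\<close>

definition cond_exp_event :: "'w measure \<Rightarrow> ('w \<Rightarrow> real) \<Rightarrow> ('w \<Rightarrow> bool) \<Rightarrow> real" where
  "cond_exp_event M f Q =
     (LINT \<omega>:{\<omega> \<in> space M. Q \<omega>}|M. f \<omega>) / \<P>(\<omega> in M. Q \<omega>)"

(* The maxima over strings x in the next two definitions range over the strings for which the
   conditional quantities are defined, i.e. the conditioning events have positive probability.
   If p_min > 0 these are all the strings. *)
definition assumption4 ::
  "'w measure \<Rightarrow> real set \<Rightarrow> (int \<Rightarrow> 'w \<Rightarrow> real) \<Rightarrow> nat \<Rightarrow> (int \<Rightarrow> real) \<Rightarrow>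
   (int \<Rightarrow> real \<Rightarrow> real pmf) \<Rightarrow> real \<Rightarrow> bool" where
  "assumption4 M A X d lam p \<Gamma> \<longleftrightarrow> 0 < \<Gamma> \<and> \<Gamma> \<le> 1 \<and>
    (\<forall>S k b c. S \<subseteq> lags d \<longrightarrow> \<not> relevant_lags A d lam p \<subseteq> S \<longrightarrow>
      k \<in> relevant_lags A d lam p - S \<longrightarrow> b \<in> A \<longrightarrow> c \<in> A \<longrightarrow> b \<noteq> c \<longrightarrow>
      \<bar>cond_mean A p k b - cond_mean A p k c\<bar> > 0 \<longrightarrow>
      finite_max {x \<in> strings A S. \<forall>e\<in>{b, c}. \<P>(\<omega> in M. agrees X S x \<omega> \<and> X k \<omega> = e) > 0}
        (\<lambda>x. \<Sum>j\<in>relevant_lags A d lam p - (S \<union> {k}).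
          lam j * \<bar>cond_exp_event M (\<lambda>\<omega>. cond_mean A p j (X j \<omega>))
                      (\<lambda>\<omega>. agrees X S x \<omega> \<and> X k \<omega> = b)
                 - cond_exp_event M (\<lambda>\<omega>. cond_mean A p j (X j \<omega>))
                      (\<lambda>\<omega>. agrees X S x \<omega> \<and> X k \<omega> = c)\<bar>
          / (lam k * \<bar>cond_mean A p k b - cond_mean A p k c\<bar>))
      \<le> 1 - \<Gamma>)"

definition assumption5 ::
  "'w measure \<Rightarrow> real set \<Rightarrow> (int \<Rightarrow> 'w \<Rightarrow> real) \<Rightarrow> nat \<Rightarrow> (int \<Rightarrow> real) \<Rightarrow>
   (int \<Rightarrow> real \<Rightarrow> real pmf) \<Rightarrow> real \<Rightarrow> bool" where
  "assumption5 M A X d lam p \<Gamma> \<longleftrightarrow> A = {0, 1} \<and> 0 < \<Gamma> \<and> \<Gamma> \<le> 1 \<and>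
    (\<forall>S k. S \<subseteq> relevant_lags A d lam p \<longrightarrow> k \<in> lags d - relevant_lags A d lam p \<longrightarrow>
      (\<Sum>j\<in>relevant_lags A d lam p - S.
        finite_max {x \<in> strings A S. \<forall>e\<in>{0, 1}. \<P>(\<omega> in M. agrees X S x \<omega> \<and> X j \<omega> = e) > 0}
          (\<lambda>x. \<bar>\<P>(\<omega> in M. X k \<omega> = 1 \<bar> agrees X S x \<omega> \<and> X j \<omega> = 1)
              - \<P>(\<omega> in M. X k \<omega> = 1 \<bar> agrees X S x \<omega> \<and> X j \<omega> = 0)\<bar>))
      \<le> \<Gamma>)"


section \<open>The FS step\<close>

(* A sample path is s :: int => real; only its values at the times 1..m are used. *)
definition emp_count ::
  "nat \<Rightarrow> nat \<Rightarrow> (int \<Rightarrow> real) \<Rightarrow> int set \<Rightarrow> (int \<Rightarrow> real) \<Rightarrow> real \<Rightarrow> nat" where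
  "emp_count d m s S x a =
     card {t \<in> {int d + 1 .. int m}. (\<forall>j\<in>S. s (t + j) = x j) \<and> s t = a}"

definition emp_prob ::
  "real set \<Rightarrow> nat \<Rightarrow> nat \<Rightarrow> (int \<Rightarrow> real) \<Rightarrow> int set \<Rightarrow> (int \<Rightarrow> real) \<Rightarrow> real" where
  "emp_prob A d m s S x = real (\<Sum>a\<in>A. emp_count d m s S x a) / (real m - real d)"

definition emp_prob_next ::
  "nat \<Rightarrow> nat \<Rightarrow> (int \<Rightarrow> real) \<Rightarrow> int set \<Rightarrow> (int \<Rightarrow> real) \<Rightarrow> real \<Rightarrow> real" where
  "emp_prob_next d m s S x a = real (emp_count d m s S x a) / (real m - real d)"

(* With r / 0 = 0, every term containing a vanishing denominator is 0: if emp_prob of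
   x(k := b) is 0, it also occurs as a factor of the term. *)
definition nu_hat ::
  "real set \<Rightarrow> nat \<Rightarrow> nat \<Rightarrow> (int \<Rightarrow> real) \<Rightarrow> int \<Rightarrow> int set \<Rightarrow> real" where
  "nu_hat A d m s k S = (\<Sum>x\<in>strings A S. emp_prob A d m s S x * (\<Sum>b\<in>A. \<Sum>c\<in>A.
     emp_prob A d m s (insert k S) (x(k := b)) * emp_prob A d m s (insert k S) (x(k := c))
       / (emp_prob A d m s S x)\<^sup>2 *
     d_TV A
       (\<lambda>a. emp_prob_next d m s (insert k S) (x(k := b)) a
              / emp_prob A d m s (insert k S) (x(k := b)))
       (\<lambda>a. emp_prob_next d m s (insert k S) (x(k := c)) a
              / emp_prob A d m s (insert k S) (x(k := c)))))"

(* Candidate sets that can occur during the greedy selection, for any resolution of ties. *)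
inductive fs_reachable :: "int set \<Rightarrow> (int \<Rightarrow> int set \<Rightarrow> real) \<Rightarrow> nat \<Rightarrow> int set \<Rightarrow> bool"
  for L :: "int set" and score :: "int \<Rightarrow> int set \<Rightarrow> real" and l :: nat where
  start: "fs_reachable L score l {}"
| step: "fs_reachable L score l S \<Longrightarrow> card S < l \<Longrightarrow> j \<in> L - S \<Longrightarrow>
    (\<And>i. i \<in> L - S \<Longrightarrow> score i S \<le> score j S) \<Longrightarrow> fs_reachable L score l (insert j S)"

definition fs_output ::
  "real set \<Rightarrow> nat \<Rightarrow> nat \<Rightarrow> nat \<Rightarrow> (int \<Rightarrow> real) \<Rightarrow> int set \<Rightarrow> bool" where
  "fs_output A d m l s S \<longleftrightarrow>
     fs_reachable (lags d) (nu_hat A d m s) l S \<and> \<not> card S < l"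

definition good_event ::
  "'w measure \<Rightarrow> real set \<Rightarrow> (int \<Rightarrow> 'w \<Rightarrow> real) \<Rightarrow> nat \<Rightarrow> nat \<Rightarrow> nat \<Rightarrow> real \<Rightarrow> 'w set" where
  "good_event M A X d m l \<xi> = {\<omega> \<in> space M. \<forall>S. S \<subseteq> lags d \<longrightarrow> card S \<le> l \<longrightarrow>
     finite_max (lags d - S) (\<lambda>j. \<bar>nu_bar M A X j S - nu_hat A d m (\<lambda>t. X t \<omega>) j S\<bar>) \<le> \<xi>}"

end

theory Submission
  imports Defs
begin

text \<open>
  On a binary alphabet, $\nu_{k,S}(x) = 2\,|\mathrm{Cov}_x(X_0, X_k)|$, and the mixture form of the
  transition probability gives
  $\mathrm{Cov}_x(X_0, X_k) = \sum_{j \in \Lambda} \pm\delta_j\,\mathrm{Cov}_x(X_j, X_k)$.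
  For $k \in \Lambda \setminus S$ the term $j = k$ is $\delta_k \mathrm{Var}_x(X_k)$, and Assumption 4
  lets the other terms cancel at most the fraction $1 - \Gamma_1$ of it; for an irrelevant lag,
  Assumption 5 bounds the sum after writing
  $\mathrm{Cov}_x(X_j, X_i) = \mathrm{Var}_x(X_j)\,(P_x(X_i = 1 | X_j = 1) - P_x(X_i = 1 | X_j = 0))$.
  With $V = \max_{k \in \Lambda \setminus S} \delta_k E[\mathrm{Var}(X_k | X_S)]$ the gap is therefore at
  least $2(\Gamma_1 - \Gamma_2) V$.

  It remains to see $E[\mathrm{Var}(X_k | X_S)] \ge p_{min}^2$.  The pointwise bound
  $P_x(X_k = b) \ge p_{min}$ can fail, because $S$ may contain times after $k$.  On average it does
  not matter: given only the past of $k$ the variance is at least $p_{min}(1 - p_{min})$,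
  revealing a later symbol $X_t$ costs at most a factor $1 - \delta_{k-t}$, and
  $\prod (1 - \delta_j) \ge 1 - \sum \delta_j \ge 2 p_{min}$.
\<close>

section \<open>Parallel sums\<close>

text \<open>Half the harmonic mean. If \<open>a\<close> and \<open>b\<close> are the masses of an
  event jointly with the two values of a bit, it is the mass of the event times the conditional
  variance of the bit. Division by zero gives 0 at \<open>a = b = 0\<close>, the right value for a
  null event.\<close>

definition parallel_sum :: "real \<Rightarrow> real \<Rightarrow> real" where
  "parallel_sum a b = a * b / (a + b)"

lemma parallel_sum_nonneg: "0 \<le> a \<Longrightarrow> 0 \<le> b \<Longrightarrow> 0 \<le> parallel_sum a b"
  by (simp add: parallel_sum_def)

lemma parallel_sum_scale: "parallel_sum (c * a) (c * b) = c * parallel_sum a b"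
proof (cases "c = 0")
  case False
  have "parallel_sum (c * a) (c * b) = (c * (c * (a * b))) / (c * (a + b))"
    by (simp add: parallel_sum_def algebra_simps)
  also have "\<dots> = c * parallel_sum a b"
    using False by (simp add: parallel_sum_def)
  finally show ?thesis .
qed (simp add: parallel_sum_def)

lemma parallel_sum_mono:
  assumes "0 \<le> a" "a \<le> a'" "0 \<le> b" "b \<le> b'"
  shows "parallel_sum a b \<le> parallel_sum a' b'"
proof (cases "a = 0 \<or> b = 0")
  case True
  then show ?thesis using assms by (auto simp: parallel_sum_def)
next
  case False
  with assms have pos: "0 < a" "0 < b" "0 < a'" "0 < b'" by auto
  \<comment> \<open>The cross-multiplied claim; its two summands need \<open>b \<le> b'\<close> and
    \<open>a \<le> a'\<close> respectively.\<close>
  have "a * b * (a' + b') \<le> a' * b' * (a + b)"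
  proof -
    have "a * (b * a') \<le> a * (b' * a')" using assms pos by (intro mult_left_mono mult_right_mono) auto
    moreover have "b * (a * b') \<le> b * (a' * b')" using assms pos by (intro mult_left_mono mult_right_mono) auto
    ultimately show ?thesis by (simp add: algebra_simps)
  qed
  then show ?thesis using pos by (simp add: parallel_sum_def divide_simps mult.commute)
qed

text \<open>The function is concave and homogeneous of degree one on nonnegative pairs. Concretely,
  the difference of the two sides is a square over a positive denominator.\<close>

lemma parallel_sum_superadditive:
  assumes "0 \<le> a" "0 \<le> b" "0 \<le> a'" "0 \<le> b'"
  shows "parallel_sum a b + parallel_sum a' b' \<le> parallel_sum (a + a') (b + b')"
proof -
  consider "a + b = 0" | "a' + b' = 0" | "0 < a + b" "0 < a' + b'"
    using assms by linarith
  then show ?thesis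
  proof cases
    case 1
    then have "a = 0" "b = 0" using assms by linarith+
    then show ?thesis by (simp add: parallel_sum_def)
  next
    case 2
    then have "a' = 0" "b' = 0" using assms by linarith+
    then show ?thesis by (simp add: parallel_sum_def)
  next
    case 3
    have "parallel_sum (a + a') (b + b') - (parallel_sum a b + parallel_sum a' b')
        = (a * b' - a' * b)\<^sup>2 / ((a + b) * (a' + b') * ((a + b) + (a' + b')))"
    proof -
      have e: "(a * b' - a' * b)\<^sup>2 = (a + a') * (b + b') * ((a + b) * (a' + b'))
        - (a * b * (a' + b') + a' * b' * (a + b)) * ((a + b) + (a' + b'))"
        by algebra
      have s: "a + a' + (b + b') = (a + b) + (a' + b')" by simp
      define u where "u = a + b"
      define v where "v = a' + b'"
      have uv: "u > 0" "v > 0" using 3 by (auto simp: u_def v_def)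
      show ?thesis
        unfolding parallel_sum_def s e unfolding u_def[symmetric] v_def[symmetric]
        using uv by (simp add: divide_simps)
    qed
    also have "\<dots> \<ge> 0" using 3 by simp
    finally show ?thesis by simp
  qed
qed

lemma sum_parallel_sum_le:
  assumes "finite I" "\<And>i. i \<in> I \<Longrightarrow> 0 \<le> f i" "\<And>i. i \<in> I \<Longrightarrow> 0 \<le> g i"
  shows "(\<Sum>i\<in>I. parallel_sum (f i) (g i)) \<le> parallel_sum (sum f I) (sum g I)"
  using assms
proof (induction I rule: finite_induct)
  case empty
  then show ?case by (simp add: parallel_sum_def)
next
  case (insert i I)
  then have "(\<Sum>i\<in>insert i I. parallel_sum (f i) (g i)) \<le> parallel_sum (f i) (g i) + parallel_sum (sum f I) (sum g I)"
    by simp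
  also have "\<dots> \<le> parallel_sum (f i + sum f I) (g i + sum g I)"
    using insert by (intro parallel_sum_superadditive sum_nonneg) auto
  finally show ?case using insert by simp
qed

text \<open>The Weierstrass product inequality; each induction step drops the nonnegative term
  \<open>f i * sum f I\<close>.\<close>

lemma prod_one_minus_ge:
  assumes "finite I" "\<And>i. i \<in> I \<Longrightarrow> 0 \<le> f i \<and> f i \<le> (1::real)"
  shows "1 - sum f I \<le> (\<Prod>i\<in>I. 1 - f i)"
  using assms
proof (induction I rule: finite_induct)
  case (insert i I)
  have "1 - (f i + sum f I) \<le> (1 - f i) * (1 - sum f I)"
    using insert by (simp add: algebra_simps sum_nonneg)
  also have "\<dots> \<le> (1 - f i) * (\<Prod>i\<in>I. 1 - f i)"
    using insert by (intro mult_left_mono) auto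
  finally show ?case using insert by simp
qed simp

section \<open>Strings and finite maxima\<close>

lemma finite_lags [simp]: "finite (lags d)"
  by (simp add: lags_def)

lemma finite_strings: "finite A \<Longrightarrow> finite S \<Longrightarrow> finite (strings A S)"
  by (simp add: strings_def finite_PiE)

lemma sum_strings_insert:
  assumes "t \<notin> T"
  shows "(\<Sum>w\<in>strings A (insert t T). g w) = (\<Sum>w\<in>strings A T. \<Sum>y\<in>A. g (w(t := y)))"
proof -
  have "strings A (insert t T) = (\<lambda>(y, w). w(t := y)) ` (A \<times> strings A T)"
    by (simp add: strings_def PiE_insert_eq)
  moreover have "inj_on (\<lambda>(y, w). w(t := y)) (A \<times> strings A T)"
    unfolding strings_def using inj_combinator[OF assms, of "\<lambda>_. A"] by simp
  ultimately have "(\<Sum>w\<in>strings A (insert t T). g w) = (\<Sum>(y, w)\<in>A \<times> strings A T. g (w(t := y)))"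
    by (simp add: sum.reindex case_prod_unfold comp_def)
  also have "\<dots> = (\<Sum>w\<in>strings A T. \<Sum>y\<in>A. g (w(t := y)))"
    by (subst sum.swap) (simp add: sum.cartesian_product)
  finally show ?thesis .
qed

lemma finite_max_upper:
  assumes "finite J" "j \<in> J"
  shows "f j \<le> finite_max J f"
  using assms by (auto simp: finite_max_def)

lemma finite_max_least:
  assumes "finite J" "\<And>j. j \<in> J \<Longrightarrow> f j \<le> c" "0 \<le> c"
  shows "finite_max J f \<le> c"
  using assms by (auto simp: finite_max_def)

lemma finite_max_attained:
  assumes "finite J" "J \<noteq> {}"
  obtains j where "j \<in> J" "finite_max J f = f j"
proof -
  have "finite_max J f \<in> f ` J"
    using Max_in[of "f ` J"] assms by (simp add: finite_max_def)
  then show ?thesis using that by auto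
qed

lemma agrees_cong: "(\<And>j. j \<in> S \<Longrightarrow> x j = y j) \<Longrightarrow> agrees X S x \<omega> = agrees X S y \<omega>"
  by (simp add: agrees_def)

lemma agrees_insert:
  "t \<notin> T \<Longrightarrow> agrees X (insert t T) (w(t := y)) \<omega> \<longleftrightarrow> agrees X T w \<omega> \<and> X t \<omega> = y"
  by (auto simp: agrees_def)

section \<open>Binary MTD models\<close>

locale binary_mtd = mtd_model +
  assumes binary: "A = {0, 1}"
begin

lemma X_in: "\<omega> \<in> space M \<Longrightarrow> X t \<omega> = 0 \<or> X t \<omega> = 1"
  using measurable_space[OF random_variables[of t]] binary by auto

lemma event_eq [measurable]: "Measurable.pred M (\<lambda>\<omega>. X t \<omega> = a)"
proof (cases "a \<in> A")
  case True
  have "X t -` {a} \<inter> space M \<in> events"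
    using random_variables[of t] True by (auto intro: measurable_sets)
  moreover have "X t -` {a} \<inter> space M = {\<omega> \<in> space M. X t \<omega> = a}" by auto
  ultimately show ?thesis by (simp add: pred_def)
next
  \<comment> \<open>Measurability into \<open>count_space A\<close> says nothing about symbols
    outside \<open>A\<close>, but these are never taken.\<close>
  case False
  then have "{\<omega> \<in> space M. X t \<omega> = a} = {}" using X_in binary by auto
  then show ?thesis by (simp only: pred_def sets.empty_sets)
qed

lemma event_agrees [measurable]: "finite S \<Longrightarrow> Measurable.pred M (\<lambda>\<omega>. agrees X S x \<omega>)"
  unfolding agrees_def by measurable

abbreviation Pr :: "('a \<Rightarrow> bool) \<Rightarrow> real" where
  "Pr Q \<equiv> \<P>(\<omega> in M. Q \<omega>)"

lemma Pr_split:
  assumes [measurable]: "Measurable.pred M Q"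
  shows "Pr Q = Pr (\<lambda>\<omega>. Q \<omega> \<and> X t \<omega> = 0) + Pr (\<lambda>\<omega>. Q \<omega> \<and> X t \<omega> = 1)"
proof -
  have "{\<omega> \<in> space M. Q \<omega>}
      = {\<omega> \<in> space M. Q \<omega> \<and> X t \<omega> = 0} \<union> {\<omega> \<in> space M. Q \<omega> \<and> X t \<omega> = 1}"
    using X_in by auto
  then show ?thesis
    by (subst finite_measure_Union[symmetric]) auto
qed

lemma Pr_mono:
  assumes [measurable]: "Measurable.pred M Q" "\<And>\<omega>. R \<omega> \<Longrightarrow> Q \<omega>"
  shows "Pr R \<le> Pr Q"
  using assms by (intro finite_measure_mono) auto

section \<open>Slopes and transition probabilities on bits\<close>

lemma binary_mass:
  assumes "j \<in> lags d" "b \<in> {0, 1}"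
  shows "pmf (p j b) 0 + pmf (p j b) 1 = 1"
proof -
  have "sum (pmf (p j b)) {0, 1} = 1"
    using p_on_alphabet[of j b] assms binary by (intro sum_pmf_eq_1) auto
  then show ?thesis by simp
qed

text \<open>The absolute value of the slope at $j$ is $\delta_j$.\<close>

definition slope :: "int \<Rightarrow> real" where
  "slope j = lam j * (pmf (p j 1) 1 - pmf (p j 0) 1)"

lemma lam_nonneg: "j \<in> lags d \<Longrightarrow> 0 \<le> lam j"
  using weights(1)[of j] by auto

lemma delta_eq:
  assumes "j \<in> lags d"
  shows "delta A lam p j = \<bar>slope j\<bar>"
proof -
  let ?u = "pmf (p j 0) 1" and ?v = "pmf (p j 1) 1"
  have z: "pmf (p j 0) 0 = 1 - ?u" "pmf (p j 1) 0 = 1 - ?v"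
    using binary_mass[OF assms, of 0] binary_mass[OF assms, of 1] by auto
  have "(MAX (b, c)\<in>A \<times> A. d_TV A (pmf (p j b)) (pmf (p j c))) = \<bar>?v - ?u\<bar>"
    by (rule Max_eqI) (auto simp: binary d_TV_def z)
  then show ?thesis using lam_nonneg[OF assms] by (simp add: delta_def slope_def abs_mult)
qed

lemma cond_mean_eq: "cond_mean A p j b = pmf (p j b) 1"
  by (simp add: cond_mean_def binary)

text \<open>The probability of the symbol 1 after the all-zero past.\<close>

definition base :: real where
  "base = lam 0 * pmf p0 1 + (\<Sum>j\<in>lags d. lam j * pmf (p j 0) 1)"

text \<open>Every function of a bit is affine, so each summand is affine in \<open>x j\<close> with
  coefficient \<open>slope j\<close>. This linearity later turns a covariance with
  \<open>X 0\<close> into a sum over lags.\<close>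

lemma trans_prob_one:
  assumes "\<And>j. j \<in> lags d \<Longrightarrow> x j \<in> {0, 1}"
  shows "trans_prob d lam p0 p 1 x = base + (\<Sum>j\<in>lags d. slope j * x j)"
proof -
  have "(\<Sum>j\<in>lags d. lam j * pmf (p j (x j)) 1)
      = (\<Sum>j\<in>lags d. lam j * pmf (p j 0) 1 + slope j * x j)"
    using assms by (intro sum.cong refl) (force simp: slope_def algebra_simps)
  then show ?thesis by (simp add: trans_prob_def base_def sum.distrib)
qed

lemma trans_prob_sum:
  assumes "\<And>j. j \<in> lags d \<Longrightarrow> x j \<in> {0, 1}"
  shows "trans_prob d lam p0 p 0 x + trans_prob d lam p0 p 1 x = 1"
proof -
  have p0: "pmf p0 0 + pmf p0 1 = 1"
    using sum_pmf_eq_1[of "{0, 1}" p0] p0_on_alphabet binary by simp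
  have "trans_prob d lam p0 p 0 x + trans_prob d lam p0 p 1 x
     = lam 0 * (pmf p0 0 + pmf p0 1) + (\<Sum>j\<in>lags d. lam j * (pmf (p j (x j)) 0 + pmf (p j (x j)) 1))"
    by (simp add: trans_prob_def sum.distrib algebra_simps)
  also have "\<dots> = lam 0 + (\<Sum>j\<in>lags d. lam j)"
    using assms by (simp add: p0 binary_mass)
  also have "\<dots> = 1" using weights(2) by (simp add: lags_def)
  finally show ?thesis .
qed

lemma trans_prob_nonneg: "0 \<le> trans_prob d lam p0 p a x"
  unfolding trans_prob_def using weights(1)[of 0] lam_nonneg
  by (intro add_nonneg_nonneg mult_nonneg_nonneg sum_nonneg) auto

abbreviation pmin :: real where
  "pmin \<equiv> p_min A d lam p0 p"

lemma finite_p_min_range: "finite ((\<lambda>(a, x). trans_prob d lam p0 p a x) ` (A \<times> strings A (lags d)))"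
  using finite_alphabet by (intro finite_imageI finite_cartesian_product finite_strings) auto

lemma p_min_le:
  assumes "\<And>j. j \<in> lags d \<Longrightarrow> x j \<in> {0, 1}" "a \<in> {0, 1}"
  shows "pmin \<le> trans_prob d lam p0 p a x"
proof -
  \<comment> \<open>\<open>p_min\<close> ranges over extensional strings, hence the restriction,
    which \<open>trans_prob\<close> does not notice.\<close>
  let ?y = "restrict x (lags d)"
  have "pmin \<le> trans_prob d lam p0 p a ?y"
    unfolding p_min_def
  proof (rule Min_le[OF finite_p_min_range])
    show "trans_prob d lam p0 p a ?y \<in> (\<lambda>(a, x). trans_prob d lam p0 p a x) ` (A \<times> strings A (lags d))"
      using assms by (intro image_eqI[of _ _ "(a, ?y)"]) (auto simp: binary strings_def)
  qed
  also have "\<dots> = trans_prob d lam p0 p a x"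
    by (simp add: trans_prob_def)
  finally show ?thesis .
qed

lemma p_min_nonneg: "0 \<le> pmin"
proof -
  have "A \<times> strings A (lags d) \<noteq> {}"
    by (auto simp: binary strings_def PiE_eq_empty_iff)
  then show ?thesis unfolding p_min_def
    by (subst Min_ge_iff[OF finite_p_min_range]) (auto simp: trans_prob_nonneg)
qed

text \<open>The slopes sum to the oscillation of the probability of the symbol 1 over all pasts, and both
  symbols have probability at least $p_{min}$.\<close>

lemma sum_slope_le: "(\<Sum>j\<in>lags d. \<bar>slope j\<bar>) \<le> 1 - 2 * pmin"
proof -
  \<comment> \<open>\<open>x\<close> and \<open>y\<close> are the pasts that maximise and minimise
    the probability of the symbol 1.\<close>
  define x :: "int \<Rightarrow> real" where "x j = of_bool (slope j \<ge> 0)" for j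
  define y :: "int \<Rightarrow> real" where "y j = of_bool (slope j < 0)" for j
  have x: "x j \<in> {0, 1}" and y: "y j \<in> {0, 1}" for j by (auto simp: x_def y_def)
  have "(\<Sum>j\<in>lags d. \<bar>slope j\<bar>) = trans_prob d lam p0 p 1 x - trans_prob d lam p0 p 1 y"
    unfolding trans_prob_one[of x, OF x] trans_prob_one[of y, OF y]
    by (simp flip: sum_subtractf, intro sum.cong) (auto simp: x_def y_def)
  also have "\<dots> = 1 - trans_prob d lam p0 p 0 x - trans_prob d lam p0 p 1 y"
    using trans_prob_sum[of x, OF x] by simp
  also have "\<dots> \<le> 1 - 2 * pmin"
    using p_min_le[of x 0, OF x] p_min_le[of y 1, OF y] by simp
  finally show ?thesis .
qed

lemma p_min_le_half: "pmin \<le> 1 / 2"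
  using sum_slope_le sum_nonneg[of "lags d" "\<lambda>j. \<bar>slope j\<bar>"] by linarith

text \<open>The Markov property with its denominator cleared, so that null pasts are covered too:
  both sides vanish there.\<close>

lemma markov_product:
  assumes "int d \<le> t - r" "a \<in> {0, 1}"
  shows "Pr (\<lambda>\<omega>. agrees X {r..t - 1} x \<omega> \<and> X t \<omega> = a)
    = Pr (agrees X {r..t - 1} x) * trans_prob d lam p0 p a (\<lambda>j. x (t + j))"
proof (cases "Pr (agrees X {r..t - 1} x) = 0")
  case True
  have "Pr (\<lambda>\<omega>. agrees X {r..t - 1} x \<omega> \<and> X t \<omega> = a) \<le> Pr (agrees X {r..t - 1} x)"
    by (rule Pr_mono) auto
  then show ?thesis using True by (simp add: measure_le_0_iff)
next
  case False
  define n where "n = nat (t - r)"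
  have n: "t - int n = r" "d \<le> n" using assms by (auto simp: n_def)
  have pos: "0 < Pr (agrees X {t - int n..t - 1} x)"
    using False unfolding n by (simp add: zero_less_measure_iff)
  have "Pr (\<lambda>\<omega>. X t \<omega> = a \<and> agrees X {r..t - 1} x \<omega>) / Pr (agrees X {r..t - 1} x)
     = trans_prob d lam p0 p a (\<lambda>j. x (t + j))"
    using markov[OF n(2) _ pos, of a] assms(2) unfolding n by (auto simp: binary cond_prob_def)
  then show ?thesis using False by (simp add: field_simps conj_commute)
qed

section \<open>Expected conditional variances\<close>

text \<open>This is $E[\mathrm{Var}(X_k | X_T)]$, since
  $P(x) \mathrm{Var}_x(X_k) = P(x, X_k = 0)\,P(x, X_k = 1) / P(x)$.\<close>

definition expvar :: "int \<Rightarrow> int set \<Rightarrow> real" where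
  "expvar k T = (\<Sum>w\<in>strings A T.
     parallel_sum (Pr (\<lambda>\<omega>. agrees X T w \<omega> \<and> X k \<omega> = 0)) (Pr (\<lambda>\<omega>. agrees X T w \<omega> \<and> X k \<omega> = 1)))"

lemma expvar_nonneg: "0 \<le> expvar k T"
  unfolding expvar_def by (intro sum_nonneg parallel_sum_nonneg) auto

text \<open>Superadditivity of \<open>parallel_sum\<close>, applied to masses split by the value of
  \<open>X t\<close>: further conditioning cannot increase the expected conditional
  variance.\<close>

lemma expvar_insert_le:
  assumes "finite T"
  shows "expvar k (insert t T) \<le> expvar k T"
proof (cases "t \<in> T")
  case False
  let ?f = "\<lambda>w y b. Pr (\<lambda>\<omega>. (agrees X T w \<omega> \<and> X t \<omega> = y) \<and> X k \<omega> = b)"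
  have "expvar k (insert t T) = (\<Sum>w\<in>strings A T. \<Sum>y\<in>A. parallel_sum (?f w y 0) (?f w y 1))"
    unfolding expvar_def sum_strings_insert[OF False] agrees_insert[OF False] ..
  also have "\<dots> \<le> (\<Sum>w\<in>strings A T. parallel_sum (\<Sum>y\<in>A. ?f w y 0) (\<Sum>y\<in>A. ?f w y 1))"
    using finite_alphabet by (intro sum_mono sum_parallel_sum_le) auto
  also have "\<dots> = expvar k T"
  proof -
    have "(\<Sum>y\<in>A. ?f w y b) = Pr (\<lambda>\<omega>. agrees X T w \<omega> \<and> X k \<omega> = b)" for w b
      using Pr_split[of "\<lambda>\<omega>. agrees X T w \<omega> \<and> X k \<omega> = b" t] assms
      by (simp add: binary conj_ac)
    then show ?thesis by (simp add: expvar_def)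
  qed
  finally show ?thesis .
qed (simp add: insert_absorb)

lemma expvar_antimono:
  assumes "finite T" "S \<subseteq> T"
  shows "expvar k T \<le> expvar k S"
proof -
  have "finite U \<Longrightarrow> expvar k (S \<union> U) \<le> expvar k S" for U
  proof (induction U rule: finite_induct)
    case (insert t U)
    then show ?case
      using expvar_insert_le[of "S \<union> U" k t] finite_subset[OF assms(2,1)] by simp
  qed simp
  from this[of T] show ?thesis using assms by (simp add: Un_absorb1)
qed

section \<open>Lower bound for the expected conditional variance\<close>

lemma sum_Pr_agrees:
  assumes "finite T" and [measurable]: "Measurable.pred M Q"
  shows "(\<Sum>w\<in>strings A T. Pr (\<lambda>\<omega>. agrees X T w \<omega> \<and> Q \<omega>)) = Pr Q"
  using assms(1)
proof (induction T rule: finite_induct)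
  case empty
  then show ?case by (simp add: strings_def agrees_def)
next
  case (insert t T)
  have "(\<Sum>w\<in>strings A (insert t T). Pr (\<lambda>\<omega>. agrees X (insert t T) w \<omega> \<and> Q \<omega>))
      = (\<Sum>w\<in>strings A T. \<Sum>y\<in>A. Pr (\<lambda>\<omega>. (agrees X T w \<omega> \<and> X t \<omega> = y) \<and> Q \<omega>))"
    unfolding sum_strings_insert[OF insert(2)] agrees_insert[OF insert(2)] ..
  also have "\<dots> = (\<Sum>w\<in>strings A T. Pr (\<lambda>\<omega>. agrees X T w \<omega> \<and> Q \<omega>))"
  proof (rule sum.cong[OF refl])
    fix w
    show "(\<Sum>y\<in>A. Pr (\<lambda>\<omega>. (agrees X T w \<omega> \<and> X t \<omega> = y) \<and> Q \<omega>)) = Pr (\<lambda>\<omega>. agrees X T w \<omega> \<and> Q \<omega>)"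
      using Pr_split[of "\<lambda>\<omega>. agrees X T w \<omega> \<and> Q \<omega>" t] insert(1) by (simp add: binary conj_ac)
  qed
  finally show ?case using insert by simp
qed

text \<open>Given a past of length at least \<open>d\<close>, the variance is a product of two
  probabilities with sum 1, both at least \<open>pmin\<close>; such a product is at least
  \<open>pmin * (1 - pmin)\<close>. Averaging over pasts keeps the bound.\<close>

lemma expvar_past_ge:
  assumes "int d \<le> k - r"
  shows "pmin * (1 - pmin) \<le> expvar k {r..k - 1}"
proof -
  let ?T = "{r..k - 1}"
  have "pmin * (1 - pmin) = (\<Sum>w\<in>strings A ?T. Pr (agrees X ?T w)) * (pmin * (1 - pmin))"
    using sum_Pr_agrees[of ?T "\<lambda>_. True"] by (simp add: prob_space)
  also have "\<dots> = (\<Sum>w\<in>strings A ?T. Pr (agrees X ?T w) * (pmin * (1 - pmin)))"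
    by (simp add: sum_distrib_right)
  also have "\<dots> \<le> expvar k ?T"
    unfolding expvar_def
  proof (rule sum_mono)
    fix w assume w: "w \<in> strings A ?T"
    let ?P = "Pr (agrees X ?T w)"
    let ?q = "\<lambda>a. trans_prob d lam p0 p a (\<lambda>j. w (k + j))"
    have b: "w (k + j) \<in> {0, 1}" if "j \<in> lags d" for j
      using w that assms by (auto simp: strings_def lags_def binary PiE_iff)
    have q: "?q 0 = 1 - ?q 1" using trans_prob_sum[of "\<lambda>j. w (k + j)", OF b] by simp
    have "0 \<le> (?q 1 - pmin) * (?q 0 - pmin)"
      using p_min_le[of "\<lambda>j. w (k + j)", OF b, of 0] p_min_le[of "\<lambda>j. w (k + j)", OF b, of 1] by simp
    then have "pmin * (1 - pmin) \<le> ?q 0 * ?q 1"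
      unfolding q by (simp add: algebra_simps)
    also have "\<dots> = parallel_sum (?q 0) (?q 1)" by (simp add: parallel_sum_def q)
    finally have "?P * (pmin * (1 - pmin)) \<le> ?P * parallel_sum (?q 0) (?q 1)"
      by (intro mult_left_mono) auto
    then show "?P * (pmin * (1 - pmin)) \<le> parallel_sum (Pr (\<lambda>\<omega>. agrees X ?T w \<omega> \<and> X k \<omega> = 0))
        (Pr (\<lambda>\<omega>. agrees X ?T w \<omega> \<and> X k \<omega> = 1))"
      using markov_product[OF assms, of 0] markov_product[OF assms, of 1] by (simp add: parallel_sum_scale)
  qed
  finally show ?thesis .
qed

text \<open>Both conditional laws of the new symbol dominate their minimum, which has total mass
  one minus the absolute slope.\<close>

lemma expvar_next_ge:
  assumes rt: "int d \<le> t - r" and k: "k - t \<in> lags d"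
  shows "(1 - \<bar>slope (k - t)\<bar>) * expvar k ({r..t - 1} - {k}) \<le> expvar k ({r..t} - {k})"
proof -
  let ?T = "{r..t - 1} - {k}"
  have kt: "k < t" "r \<le> k" using k rt by (auto simp: lags_def)
  \<comment> \<open>\<open>t\<close> is split off as the revealed symbol, while adding
    \<open>k\<close> back completes the past of \<open>t\<close> on which the Markov property is
    available.\<close>
  have T: "{r..t} - {k} = insert t ?T" "t \<notin> ?T" "insert k ?T = {r..t - 1}" "k \<notin> ?T"
    using kt rt by auto
  let ?f = "\<lambda>w b. Pr (\<lambda>\<omega>. agrees X ?T w \<omega> \<and> X k \<omega> = b)"
  have "(1 - \<bar>slope (k - t)\<bar>) * expvar k ?T
      = (\<Sum>w\<in>strings A ?T. (1 - \<bar>slope (k - t)\<bar>) * parallel_sum (?f w 0) (?f w 1))"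
    by (simp add: expvar_def sum_distrib_left)
  also have "\<dots> \<le> (\<Sum>w\<in>strings A ?T. \<Sum>y\<in>A.
      parallel_sum (Pr (\<lambda>\<omega>. (agrees X ?T w \<omega> \<and> X t \<omega> = y) \<and> X k \<omega> = 0))
         (Pr (\<lambda>\<omega>. (agrees X ?T w \<omega> \<and> X t \<omega> = y) \<and> X k \<omega> = 1)))"
  proof (rule sum_mono)
    fix w assume w: "w \<in> strings A ?T"
    define u where "u b y = trans_prob d lam p0 p y (\<lambda>j. (w(k := b)) (t + j))" for b y
    have bin: "(w(k := b)) (t + j) \<in> {0, 1}" if "j \<in> lags d" "b \<in> {0, 1}" for j b
      using w that rt by (auto simp: strings_def lags_def binary PiE_iff)
    have step: "Pr (\<lambda>\<omega>. (agrees X ?T w \<omega> \<and> X t \<omega> = y) \<and> X k \<omega> = b) = u b y * ?f w b"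
      if "y \<in> {0, 1}" for y b
    proof -
      have "Pr (\<lambda>\<omega>. agrees X {r..t - 1} (w(k := b)) \<omega> \<and> X t \<omega> = y)
          = Pr (agrees X {r..t - 1} (w(k := b))) * u b y"
        unfolding u_def by (rule markov_product[OF rt that])
      moreover have "agrees X {r..t - 1} (w(k := b)) \<omega> \<longleftrightarrow> agrees X ?T w \<omega> \<and> X k \<omega> = b" for \<omega>
        using agrees_insert[OF T(4), of X w b \<omega>] unfolding T(3) .
      ultimately show ?thesis by (simp add: conj_ac mult.commute)
    qed
    have u_sum: "u b 0 = 1 - u b 1" if "b \<in> {0, 1}" for b
      unfolding u_def
      using trans_prob_sum[of "\<lambda>j. (w(k := b)) (t + j)", OF bin[OF _ that]] by linarith
    have u_diff: "u 1 1 - u 0 1 = slope (k - t)"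
    proof -
      have "u 1 1 - u 0 1 = (\<Sum>j\<in>lags d. slope j * ((w(k := 1)) (t + j) - (w(k := 0)) (t + j)))"
        using trans_prob_one[of "\<lambda>j. (w(k := 1)) (t + j)", OF bin[of _ 1]]
          trans_prob_one[of "\<lambda>j. (w(k := 0)) (t + j)", OF bin[of _ 0]]
        unfolding u_def by (simp add: sum_subtractf right_diff_distrib)
      \<comment> \<open>The two pasts differ only at time \<open>k\<close>, which is lag
        \<open>k - t\<close> seen from \<open>t\<close>.\<close>
      also have "\<dots> = (\<Sum>j\<in>lags d. if j = k - t then slope j else 0)"
        by (intro sum.cong) auto
      finally show ?thesis using k by simp
    qed
    have u_nonneg: "0 \<le> u b y" for b y by (simp add: u_def trans_prob_nonneg)
    have "min (u 0 0) (u 1 0) + min (u 0 1) (u 1 1) = 1 - \<bar>slope (k - t)\<bar>"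
      using u_diff u_sum[of 0] u_sum[of 1] by auto
    then have "(1 - \<bar>slope (k - t)\<bar>) * parallel_sum (?f w 0) (?f w 1)
        = (\<Sum>y\<in>A. parallel_sum (min (u 0 y) (u 1 y) * ?f w 0) (min (u 0 y) (u 1 y) * ?f w 1))"
      by (simp add: parallel_sum_scale binary flip: distrib_right)
    also have "\<dots> \<le> (\<Sum>y\<in>A. parallel_sum (u 0 y * ?f w 0) (u 1 y * ?f w 1))"
      using u_nonneg by (intro sum_mono parallel_sum_mono mult_right_mono) auto
    also have "\<dots> = (\<Sum>y\<in>A.
      parallel_sum (Pr (\<lambda>\<omega>. (agrees X ?T w \<omega> \<and> X t \<omega> = y) \<and> X k \<omega> = 0))
         (Pr (\<lambda>\<omega>. (agrees X ?T w \<omega> \<and> X t \<omega> = y) \<and> X k \<omega> = 1)))"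
      using step binary by (intro sum.cong) auto
    finally show "(1 - \<bar>slope (k - t)\<bar>) * parallel_sum (?f w 0) (?f w 1) \<le> \<dots>" .
  qed
  also have "\<dots> = expvar k ({r..t} - {k})"
    unfolding expvar_def T(1) sum_strings_insert[OF T(2)] agrees_insert[OF T(2)] ..
  finally show ?thesis .
qed

lemma abs_slope_le_one: "j \<in> lags d \<Longrightarrow> \<bar>slope j\<bar> \<le> 1"
  using sum_slope_le p_min_nonneg member_le_sum[of j "lags d" "\<lambda>j. \<bar>slope j\<bar>"] by simp

text \<open>Starts from the past of \<open>k\<close> and reveals the times \<open>k + 1\<close> to
  \<open>k + n\<close> one by one; time \<open>k + i\<close> costs the factor of lag
  \<open>- i\<close>. Since \<open>k\<close> is at least \<open>- int d\<close>, the left end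
  \<open>- 2 * int d\<close> leaves at least \<open>d\<close> times before \<open>k\<close>.\<close>

lemma expvar_window_ge:
  assumes k: "k \<in> lags d" and n: "int n \<le> - 1 - k"
  shows "(\<Prod>i\<in>{1..n}. 1 - \<bar>slope (- int i)\<bar>) * (pmin * (1 - pmin))
    \<le> expvar k ({- 2 * int d..k + int n} - {k})"
  using n
proof (induction n)
  case 0
  have "{- 2 * int d..k + int 0} - {k} = {- 2 * int d..k - 1}" by auto
  then show ?case using expvar_past_ge[of k "- 2 * int d"] k by (simp add: lags_def)
next
  case (Suc n)
  define t where "t = k + int (Suc n)"
  have t: "k - t = - int (Suc n)" "t - 1 = k + int n" by (auto simp: t_def)
  have l: "k - t \<in> lags d" using k Suc.prems unfolding t by (auto simp: lags_def)
  have "(\<Prod>i\<in>{1..Suc n}. 1 - \<bar>slope (- int i)\<bar>) * (pmin * (1 - pmin))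
     = (1 - \<bar>slope (k - t)\<bar>) * ((\<Prod>i\<in>{1..n}. 1 - \<bar>slope (- int i)\<bar>) * (pmin * (1 - pmin)))"
    by (simp add: t prod.nat_ivl_Suc' algebra_simps)
  also have "\<dots> \<le> (1 - \<bar>slope (k - t)\<bar>) * expvar k ({- 2 * int d..t - 1} - {k})"
    using Suc abs_slope_le_one[OF l] unfolding t(2) by (intro mult_left_mono) auto
  also have "\<dots> \<le> expvar k ({- 2 * int d..t} - {k})"
    using k by (intro expvar_next_ge l) (auto simp: t_def lags_def)
  finally show ?case by (simp only: t_def)
qed

text \<open>By antimonotonicity \<open>S\<close> may be enlarged to all times from
  \<open>- 2 * int d\<close> to -1 except \<open>k\<close>. The symbols after \<open>k\<close> leave
  at least the fraction \<open>2 * pmin\<close> of \<open>pmin * (1 - pmin)\<close>, and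
  \<open>pmin \<le> 1 / 2\<close> absorbs the factor \<open>2 * (1 - pmin)\<close>.\<close>

lemma expvar_ge:
  assumes k: "k \<in> lags d" and S: "S \<subseteq> lags d" "k \<notin> S"
  shows "pmin\<^sup>2 \<le> expvar k S"
proof -
  \<comment> \<open>The number of times strictly between \<open>k\<close> and 0, so
    \<open>k + int n\<close> is -1.\<close>
  define n where "n = nat (- 1 - k)"
  have n: "int n = - 1 - k" using k by (auto simp: n_def lags_def)
  have inj: "inj_on (\<lambda>i. - int i) {1..n}" by (auto simp: inj_on_def)
  have sub: "(\<lambda>i. - int i) ` {1..n} \<subseteq> lags d" using n k by (auto simp: lags_def)
  have "2 * pmin \<le> 1 - (\<Sum>j\<in>lags d. \<bar>slope j\<bar>)" using sum_slope_le by simp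
  also have "\<dots> \<le> 1 - (\<Sum>i\<in>{1..n}. \<bar>slope (- int i)\<bar>)"
    using sum_mono2[OF finite_lags sub, of "\<lambda>j. \<bar>slope j\<bar>"] unfolding sum.reindex[OF inj] comp_def by simp
  also have "\<dots> \<le> (\<Prod>i\<in>{1..n}. 1 - \<bar>slope (- int i)\<bar>)"
    using sub abs_slope_le_one by (intro prod_one_minus_ge) (auto simp: image_subset_iff)
  finally have pr: "2 * pmin \<le> (\<Prod>i\<in>{1..n}. 1 - \<bar>slope (- int i)\<bar>)" .
  have "pmin\<^sup>2 * 1 \<le> pmin\<^sup>2 * (2 * (1 - pmin))"
    using p_min_le_half by (intro mult_left_mono) auto
  also have "\<dots> = 2 * pmin * (pmin * (1 - pmin))" by (simp add: power2_eq_square)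
  also have "\<dots> \<le> (\<Prod>i\<in>{1..n}. 1 - \<bar>slope (- int i)\<bar>) * (pmin * (1 - pmin))"
    using pr p_min_nonneg p_min_le_half by (intro mult_right_mono) auto
  also have "\<dots> \<le> expvar k ({- 2 * int d..k + int n} - {k})"
    using n by (intro expvar_window_ge k) auto
  also have "\<dots> \<le> expvar k S"
    using S n by (intro expvar_antimono) (auto simp: lags_def)
  finally show ?thesis by simp
qed


section \<open>Conditional covariances\<close>

text \<open>The covariance of $X_i$ and $X_k$ given $Q$, multiplied by $P(Q)^2$ so that no null event has to
  be excluded.\<close>

definition cdet :: "('a \<Rightarrow> bool) \<Rightarrow> int \<Rightarrow> int \<Rightarrow> real" where
  "cdet Q i k = Pr (\<lambda>\<omega>. Q \<omega> \<and> X i \<omega> = 1 \<and> X k \<omega> = 1) * Pr Q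
     - Pr (\<lambda>\<omega>. Q \<omega> \<and> X i \<omega> = 1) * Pr (\<lambda>\<omega>. Q \<omega> \<and> X k \<omega> = 1)"

lemma cdet_commute: "cdet Q i k = cdet Q k i"
  by (simp add: cdet_def conj_commute mult.commute)

text \<open>Splitting \<open>Pr Q\<close> and the mass of \<open>X i = 1\<close> by the value of
  \<open>X k\<close> makes the mixed products cancel.\<close>

lemma cdet_eq:
  assumes [measurable]: "Measurable.pred M Q"
  shows "cdet Q i k
    = Pr (\<lambda>\<omega>. Q \<omega> \<and> X i \<omega> = 1 \<and> X k \<omega> = 1) * Pr (\<lambda>\<omega>. Q \<omega> \<and> X k \<omega> = 0)
    - Pr (\<lambda>\<omega>. Q \<omega> \<and> X i \<omega> = 1 \<and> X k \<omega> = 0) * Pr (\<lambda>\<omega>. Q \<omega> \<and> X k \<omega> = 1)"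
proof -
  have "Pr Q = Pr (\<lambda>\<omega>. Q \<omega> \<and> X k \<omega> = 0) + Pr (\<lambda>\<omega>. Q \<omega> \<and> X k \<omega> = 1)"
    by (rule Pr_split) simp
  moreover have "Pr (\<lambda>\<omega>. Q \<omega> \<and> X i \<omega> = 1)
      = Pr (\<lambda>\<omega>. Q \<omega> \<and> X i \<omega> = 1 \<and> X k \<omega> = 0) + Pr (\<lambda>\<omega>. Q \<omega> \<and> X i \<omega> = 1 \<and> X k \<omega> = 1)"
    using Pr_split[of "\<lambda>\<omega>. Q \<omega> \<and> X i \<omega> = 1" k] by (simp add: conj_assoc)
  ultimately show ?thesis by (simp add: cdet_def algebra_simps)
qed

text \<open>Covariance with a bit is its variance times the jump of the conditional probability of
  \<open>X i = 1\<close>. Both dependence assumptions are stated through such jumps.\<close>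

lemma cdet_eq_cond:
  assumes [measurable]: "Measurable.pred M Q"
    and pos: "Pr (\<lambda>\<omega>. Q \<omega> \<and> X k \<omega> = 0) > 0" "Pr (\<lambda>\<omega>. Q \<omega> \<and> X k \<omega> = 1) > 0"
  shows "cdet Q i k = Pr (\<lambda>\<omega>. Q \<omega> \<and> X k \<omega> = 0) * Pr (\<lambda>\<omega>. Q \<omega> \<and> X k \<omega> = 1) *
    (Pr (\<lambda>\<omega>. Q \<omega> \<and> X i \<omega> = 1 \<and> X k \<omega> = 1) / Pr (\<lambda>\<omega>. Q \<omega> \<and> X k \<omega> = 1)
     - Pr (\<lambda>\<omega>. Q \<omega> \<and> X i \<omega> = 1 \<and> X k \<omega> = 0) / Pr (\<lambda>\<omega>. Q \<omega> \<and> X k \<omega> = 0))"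
  unfolding cdet_eq[OF assms(1)] using pos by (simp add: field_simps)

text \<open>\<open>X k\<close> is then almost surely constant on \<open>Q\<close>. This complements
  \<open>cdet_eq_cond\<close>, so every \<open>Q\<close> is covered.\<close>

lemma cdet_null:
  assumes [measurable]: "Measurable.pred M Q"
    and "Pr (\<lambda>\<omega>. Q \<omega> \<and> X k \<omega> = 0) = 0 \<or> Pr (\<lambda>\<omega>. Q \<omega> \<and> X k \<omega> = 1) = 0"
  shows "cdet Q i k = 0"
proof -
  have "Pr (\<lambda>\<omega>. Q \<omega> \<and> X i \<omega> = 1 \<and> X k \<omega> = b) \<le> Pr (\<lambda>\<omega>. Q \<omega> \<and> X k \<omega> = b)" for b
    by (rule Pr_mono) auto
  from this[of 0] this[of 1] show ?thesis
    using assms(2) unfolding cdet_eq[OF assms(1)] by (auto simp: measure_le_0_iff)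
qed

text \<open>The string fixes \<open>X j\<close>, and a constant has covariance zero with
  everything.\<close>

lemma cdet_agrees_eq_0:
  assumes "j \<in> S"
  shows "cdet (agrees X S x) j k = 0"
proof (cases "x j = 1")
  case True
  then have "(agrees X S x \<omega> \<and> X j \<omega> = 1 \<and> R) \<longleftrightarrow> agrees X S x \<omega> \<and> R" for \<omega> R
    using assms by (auto simp: agrees_def)
  \<comment> \<open>The instance \<open>R = True\<close> handles the event that carries no condition
    on \<open>X k\<close>.\<close>
  from this this[of _ True] show ?thesis by (simp add: cdet_def)
next
  case False
  then have "\<not> (agrees X S x \<omega> \<and> X j \<omega> = 1)" for \<omega>
    using assms by (auto simp: agrees_def)
  then have "{\<omega> \<in> space M. agrees X S x \<omega> \<and> X j \<omega> = 1} = {}"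
    "{\<omega> \<in> space M. agrees X S x \<omega> \<and> X j \<omega> = 1 \<and> X k \<omega> = 1} = {}" by blast+
  then show ?thesis unfolding cdet_def by (simp only: measure_empty)
qed

text \<open>Both sides are additive over the values at a further lag, so it suffices to know the formula
  for complete pasts.\<close>

lemma Pr_next_one:
  assumes "T \<subseteq> lags d" "\<And>j. j \<in> T \<Longrightarrow> x j \<in> {0, 1}"
  shows "Pr (\<lambda>\<omega>. agrees X T x \<omega> \<and> X 0 \<omega> = 1)
    = base * Pr (agrees X T x) + (\<Sum>j\<in>lags d. slope j * Pr (\<lambda>\<omega>. agrees X T x \<omega> \<and> X j \<omega> = 1))"
proof -
  \<comment> \<open>Induction over the lags \<open>U\<close> still to be added to \<open>T\<close>,
    down to \<open>T = lags d\<close>. \<open>T\<close> and \<open>U\<close> may overlap, so that it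
    can be started with \<open>U = lags d\<close>.\<close>
  have "Pr (\<lambda>\<omega>. agrees X T x \<omega> \<and> X 0 \<omega> = 1)
    = base * Pr (agrees X T x) + (\<Sum>j\<in>lags d. slope j * Pr (\<lambda>\<omega>. agrees X T x \<omega> \<and> X j \<omega> = 1))"
    if "finite U" "T \<union> U = lags d" "T \<subseteq> lags d" "\<And>j. j \<in> T \<Longrightarrow> x j \<in> {0, 1}" for U T x
    using that
  proof (induction U arbitrary: T x rule: finite_induct)
    case empty
    then have T: "T = lags d" by simp
    have "Pr (\<lambda>\<omega>. agrees X T x \<omega> \<and> X j \<omega> = 1) = Pr (agrees X T x) * x j" if j: "j \<in> lags d" for j
    proof (cases "x j = 1")
      case True
      then have "(agrees X T x \<omega> \<and> X j \<omega> = 1) \<longleftrightarrow> agrees X T x \<omega>" for \<omega>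
        using j T by (auto simp: agrees_def)
      then show ?thesis using True by simp
    next
      case False
      then have e: "{\<omega> \<in> space M. agrees X T x \<omega> \<and> X j \<omega> = 1} = {}"
        using j T by (auto simp: agrees_def)
      show ?thesis unfolding e using False empty(3)[of j] j T by simp
    qed
    then have "base * Pr (agrees X T x) + (\<Sum>j\<in>lags d. slope j * Pr (\<lambda>\<omega>. agrees X T x \<omega> \<and> X j \<omega> = 1))
      = Pr (agrees X T x) * trans_prob d lam p0 p 1 x"
      using empty(3) T by (subst trans_prob_one) (auto simp: distrib_left sum_distrib_left sum_distrib_right mult_ac)
    also have "\<dots> = Pr (\<lambda>\<omega>. agrees X T x \<omega> \<and> X 0 \<omega> = 1)"
      using markov_product[of 0 "- int d" 1 x] T by (simp add: lags_def)
    finally show ?case by simp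
  next
    case (insert i U)
    show ?case
    proof (cases "i \<in> T")
      case True
      then have "T \<union> U = lags d" using insert.prems(1) by auto
      then show ?thesis using insert.prems by (intro insert.IH)
    next
      case False
      have fin: "finite T" using finite_subset[OF insert.prems(2)] by simp
      have IH: "Pr (\<lambda>\<omega>. (agrees X T x \<omega> \<and> X i \<omega> = b) \<and> X 0 \<omega> = 1)
        = base * Pr (\<lambda>\<omega>. agrees X T x \<omega> \<and> X i \<omega> = b)
          + (\<Sum>j\<in>lags d. slope j * Pr (\<lambda>\<omega>. (agrees X T x \<omega> \<and> X i \<omega> = b) \<and> X j \<omega> = 1))"
        if b: "b \<in> {0, 1}" for b
        unfolding agrees_insert[OF False, symmetric]
        using insert.prems b by (intro insert.IH) auto
      have split: "Pr (\<lambda>\<omega>. agrees X T x \<omega> \<and> X j \<omega> = 1)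
        = Pr (\<lambda>\<omega>. (agrees X T x \<omega> \<and> X i \<omega> = 0) \<and> X j \<omega> = 1)
          + Pr (\<lambda>\<omega>. (agrees X T x \<omega> \<and> X i \<omega> = 1) \<and> X j \<omega> = 1)" for j
        using Pr_split[of "\<lambda>\<omega>. agrees X T x \<omega> \<and> X j \<omega> = 1" i] fin by (simp add: conj_ac)
      have split': "Pr (agrees X T x)
        = Pr (\<lambda>\<omega>. agrees X T x \<omega> \<and> X i \<omega> = 0) + Pr (\<lambda>\<omega>. agrees X T x \<omega> \<and> X i \<omega> = 1)"
        using Pr_split[of "agrees X T x" i] fin by simp
      show ?thesis
        unfolding split using IH[of 0] IH[of 1] split'
        by (simp add: sum.distrib distrib_left)
    qed
  qed
  from this[OF finite_lags Un_absorb1[OF assms(1)] assms] show ?thesis .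
qed

text \<open>Covariance is linear and ignores constants: with \<open>Pr_next_one\<close> inserted for
  both values of \<open>X k\<close>, the terms with \<open>base\<close> cancel.\<close>

lemma cdet_next:
  assumes S: "S \<subseteq> lags d" and k: "k \<in> lags d - S" and x: "\<And>j. j \<in> S \<Longrightarrow> x j \<in> {0, 1}"
  shows "cdet (agrees X S x) 0 k = (\<Sum>j\<in>lags d. slope j * cdet (agrees X S x) j k)"
proof -
  have fin: "finite S" using finite_subset[OF S] by simp
  have kS: "k \<notin> S" using k by simp
  let ?Q = "agrees X S x"
  have R: "Pr (\<lambda>\<omega>. ?Q \<omega> \<and> X 0 \<omega> = 1 \<and> X k \<omega> = b) = base * Pr (\<lambda>\<omega>. ?Q \<omega> \<and> X k \<omega> = b)
      + (\<Sum>j\<in>lags d. slope j * Pr (\<lambda>\<omega>. ?Q \<omega> \<and> X j \<omega> = 1 \<and> X k \<omega> = b))" if "b \<in> {0, 1}" for b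
  proof -
    have "(x(k := b)) j \<in> {0, 1}" if "j \<in> insert k S" for j
      using that x[of j] \<open>b \<in> {0, 1}\<close> by auto
    from Pr_next_one[of "insert k S" "x(k := b)", OF _ this] show ?thesis
      using S k unfolding agrees_insert[OF kS] by (simp add: conj_ac)
  qed
  show ?thesis
    using fin by (simp add: cdet_eq R sum_distrib_left sum_distrib_right algebra_simps flip: sum_subtractf)
qed

section \<open>Reduction to the relevant lags\<close>

abbreviation relevant :: "int set" where
  "relevant \<equiv> relevant_lags A d lam p"

lemma relevant_iff: "j \<in> relevant \<longleftrightarrow> j \<in> lags d \<and> slope j \<noteq> 0"
  using delta_eq by (auto simp: relevant_lags_def)

lemma relevant_subset: "relevant \<subseteq> lags d"
  by (auto simp: relevant_lags_def)

lemma finite_relevant [simp]: "finite relevant"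
  using finite_subset[OF relevant_subset] by simp

text \<open>Irrelevant lags have slope 0, and lags in \<open>S\<close> have covariance 0.\<close>

lemma cdet_next_relevant:
  assumes S: "S \<subseteq> lags d" and k: "k \<in> lags d - S" and x: "x \<in> strings A S"
  shows "cdet (agrees X S x) 0 k = (\<Sum>j\<in>relevant - S. slope j * cdet (agrees X S x) j k)"
proof -
  have "cdet (agrees X S x) 0 k = (\<Sum>j\<in>lags d. slope j * cdet (agrees X S x) j k)"
    using x by (intro cdet_next S k) (auto simp: strings_def binary PiE_iff)
  also have "\<dots> = (\<Sum>j\<in>relevant - S. slope j * cdet (agrees X S x) j k)"
    using relevant_subset
    by (intro sum.mono_neutral_right) (auto simp: relevant_iff cdet_agrees_eq_0)
  finally show ?thesis .
qed

text \<open>Only the pairs \<open>b \<noteq> c\<close> contribute to \<open>nu\<close>, both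
  equally, whence the 2; the total variation distance of two laws on bits is the difference of their
  masses at 1. So \<open>nu\<close> is twice the absolute conditional covariance. For null strings
  both sides are 0.\<close>

lemma Pr_times_nu:
  assumes "finite S"
  shows "Pr (agrees X S x) * nu M A X k S x
    = 2 * \<bar>cdet (agrees X S x) 0 k\<bar> / Pr (agrees X S x)"
proof -
  let ?Q = "agrees X S x"
  note [measurable] = event_agrees[OF assms]
  let ?a = "Pr (\<lambda>\<omega>. ?Q \<omega> \<and> X k \<omega> = 0)" and ?b = "Pr (\<lambda>\<omega>. ?Q \<omega> \<and> X k \<omega> = 1)"
  let ?R = "\<lambda>a b. Pr (\<lambda>\<omega>. ?Q \<omega> \<and> X 0 \<omega> = a \<and> X k \<omega> = b)"
  define D where "D = d_TV A (\<lambda>a. ?R a 1 / ?b) (\<lambda>a. ?R a 0 / ?a)"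
  have sym: "d_TV A \<mu> \<nu> = d_TV A \<nu> \<mu>" "d_TV A \<mu> \<mu> = 0" for \<mu> \<nu>
    by (auto simp: d_TV_def abs_minus_commute)
  have c: "\<P>(\<omega> in M. X 0 \<omega> = a \<bar> ?Q \<omega> \<and> X k \<omega> = b) = ?R a b / Pr (\<lambda>\<omega>. ?Q \<omega> \<and> X k \<omega> = b)"
    "\<P>(\<omega> in M. X k \<omega> = b \<bar> ?Q \<omega>) = Pr (\<lambda>\<omega>. ?Q \<omega> \<and> X k \<omega> = b) / Pr ?Q" for a b
    by (simp_all add: cond_prob_def conj_ac)
  have nu: "nu M A X k S x = 2 * (?a / Pr ?Q * (?b / Pr ?Q) * D)"
    unfolding nu_def c using sym(1)[of "\<lambda>a. ?R a 0 / ?a" "\<lambda>a. ?R a 1 / ?b"]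
    by (simp add: binary sym(2)[unfolded binary] D_def)
  have main: "?a * ?b * D = \<bar>cdet ?Q 0 k\<bar>"
  proof (cases "?a = 0 \<or> ?b = 0")
    case True
    then show ?thesis using cdet_null[of ?Q k 0] by auto
  next
    case False
    then have pos: "?a > 0" "?b > 0" by (auto simp: zero_less_measure_iff)
    have R: "?R 0 b = Pr (\<lambda>\<omega>. ?Q \<omega> \<and> X k \<omega> = b) - ?R 1 b" for b
      using Pr_split[of "\<lambda>\<omega>. ?Q \<omega> \<and> X k \<omega> = b" 0] by (simp add: conj_ac)
    have "D = \<bar>?R 1 1 / ?b - ?R 1 0 / ?a\<bar>"
      using pos by (simp add: D_def d_TV_def binary R diff_divide_distrib)
    moreover have "\<bar>cdet ?Q 0 k\<bar> = ?a * ?b * \<bar>?R 1 1 / ?b - ?R 1 0 / ?a\<bar>"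
      using cdet_eq_cond[OF _ pos, of 0] by (simp add: abs_mult)
    ultimately show ?thesis by simp
  qed
  show ?thesis unfolding nu main[symmetric] by (cases "Pr ?Q = 0") (simp_all add: field_simps)
qed

lemma integrable_event:
  assumes [measurable]: "Measurable.pred M Q"
  shows "integrable M (indicat_real {\<omega> \<in> space M. Q \<omega>})"
  by (intro integrable_real_indicator) (auto simp: less_top[symmetric])

text \<open>The observed string takes finitely many values, so the integrand is a finite combination
  of indicators. \<open>restrict\<close> makes the path an element of \<open>strings A S\<close>
  without changing \<open>nu\<close>.\<close>

lemma nu_bar_eq:
  assumes "finite S"
  shows "nu_bar M A X k S
    = (\<Sum>x\<in>strings A S. 2 * \<bar>cdet (agrees X S x) 0 k\<bar> / Pr (agrees X S x))"
proof -
  note fin = finite_strings[OF finite_alphabet(1) assms]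
  have "nu_bar M A X k S
     = (\<integral>\<omega>. (\<Sum>x\<in>strings A S. indicator {\<omega> \<in> space M. agrees X S x \<omega>} \<omega> * nu M A X k S x) \<partial>M)"
    unfolding nu_bar_def
  proof (rule Bochner_Integration.integral_cong[OF refl])
    fix \<omega> assume \<omega>: "\<omega> \<in> space M"
    let ?y = "restrict (\<lambda>j. X j \<omega>) S"
    have ag: "agrees X S (\<lambda>j. X j \<omega>) = agrees X S ?y"
      by (auto simp: agrees_def fun_eq_iff)
    have "nu M A X k S (\<lambda>j. X j \<omega>) = nu M A X k S ?y"
      unfolding nu_def ag ..
    also have "\<dots> = (\<Sum>x\<in>strings A S. if x = ?y then nu M A X k S x else 0)"
      using fin X_in[OF \<omega>] by (auto simp: strings_def binary)
    also have "\<dots> = (\<Sum>x\<in>strings A S. indicator {\<omega> \<in> space M. agrees X S x \<omega>} \<omega> * nu M A X k S x)"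
    proof (rule sum.cong[OF refl])
      fix x assume x: "x \<in> strings A S"
      have "x = ?y \<longleftrightarrow> agrees X S x \<omega>"
        using x by (auto simp: strings_def agrees_def PiE_iff extensional_def fun_eq_iff)
      then show "(if x = ?y then nu M A X k S x else 0)
        = indicator {\<omega> \<in> space M. agrees X S x \<omega>} \<omega> * nu M A X k S x"
        using \<omega> by (simp add: indicator_def)
    qed
    finally show "nu M A X k S (\<lambda>j. X j \<omega>) = \<dots>" .
  qed
  also have "\<dots> = (\<Sum>x\<in>strings A S. Pr (agrees X S x) * nu M A X k S x)"
    using integrable_event[OF event_agrees[OF assms]]
    by (subst Bochner_Integration.integral_sum) (auto simp: Int_absorb2)
  finally show ?thesis using Pr_times_nu[OF assms] by simp
qed

text \<open>\<open>cond_mean\<close> is affine on bits, so only the conditional probability of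
  \<open>X j = 1\<close> enters. This links \<open>assumption4\<close> to
  \<open>cdet\<close>.\<close>

lemma cond_exp_event_mean:
  assumes [measurable]: "Measurable.pred M E" and pos: "Pr E > 0"
  shows "cond_exp_event M (\<lambda>\<omega>. cond_mean A p j (X j \<omega>)) E
    = pmf (p j 0) 1 + (pmf (p j 1) 1 - pmf (p j 0) 1) * (Pr (\<lambda>\<omega>. E \<omega> \<and> X j \<omega> = 1) / Pr E)"
proof -
  have "(LINT \<omega>:{\<omega> \<in> space M. E \<omega>}|M. cond_mean A p j (X j \<omega>))
    = (\<integral>\<omega>. indicator {\<omega> \<in> space M. E \<omega>} \<omega> * pmf (p j 0) 1
        + indicator {\<omega> \<in> space M. E \<omega> \<and> X j \<omega> = 1} \<omega> * (pmf (p j 1) 1 - pmf (p j 0) 1) \<partial>M)"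
    unfolding set_lebesgue_integral_def cond_mean_eq
    using X_in by (intro Bochner_Integration.integral_cong) (force simp: indicator_def)+
  also have "\<dots> = Pr E * pmf (p j 0) 1 + Pr (\<lambda>\<omega>. E \<omega> \<and> X j \<omega> = 1) * (pmf (p j 1) 1 - pmf (p j 0) 1)"
    using integrable_event[of E] integrable_event[of "\<lambda>\<omega>. E \<omega> \<and> X j \<omega> = 1"]
    by (subst Bochner_Integration.integral_add) auto
  finally show ?thesis
    using pos by (simp add: cond_exp_event_def field_simps)
qed

section \<open>The gap and the FS step\<close>

text \<open>For each string, the covariance with \<open>X 0\<close> has the main term
  \<open>j = k\<close>, a multiple of the variance of \<open>X k\<close>; \<open>assumption4\<close>
  allows the other terms to cancel at most the fraction \<open>1 - \<Gamma>\<close> of it. Summing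
  over strings gives \<open>expvar\<close>.\<close>

lemma nu_bar_relevant_ge:
  assumes A4: "assumption4 M A X d lam p \<Gamma>"
    and S: "S \<subset> relevant" and k: "k \<in> relevant - S"
  shows "2 * \<Gamma> * (\<bar>slope k\<bar> * expvar k S) \<le> nu_bar M A X k S"
proof -
  have Sl: "S \<subseteq> lags d" using S relevant_subset by auto
  have fin: "finite S" using finite_subset[OF Sl] by simp
  have kl: "k \<in> lags d - S" "slope k \<noteq> 0" using k by (auto simp: relevant_iff)
  have "2 * \<Gamma> * (\<bar>slope k\<bar> * expvar k S)
    = (\<Sum>x\<in>strings A S. 2 * \<Gamma> * (\<bar>slope k\<bar> *
        parallel_sum (Pr (\<lambda>\<omega>. agrees X S x \<omega> \<and> X k \<omega> = 0)) (Pr (\<lambda>\<omega>. agrees X S x \<omega> \<and> X k \<omega> = 1))))"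
    by (simp add: expvar_def sum_distrib_left)
  also have "\<dots> \<le> (\<Sum>x\<in>strings A S. 2 * \<bar>cdet (agrees X S x) 0 k\<bar> / Pr (agrees X S x))"
  proof (rule sum_mono)
    fix x assume x: "x \<in> strings A S"
    let ?Q = "agrees X S x"
    note [measurable] = event_agrees[OF fin, of x]
    let ?a = "Pr (\<lambda>\<omega>. ?Q \<omega> \<and> X k \<omega> = 0)" and ?b = "Pr (\<lambda>\<omega>. ?Q \<omega> \<and> X k \<omega> = 1)"
    have empty: "{\<omega> \<in> space M. ?Q \<omega> \<and> X k \<omega> = 1 \<and> X k \<omega> = 0} = {}" by auto
    have kk: "cdet ?Q k k = ?a * ?b"
      by (subst cdet_eq) (simp_all only: empty measure_empty, simp_all)
    have key: "\<Gamma> * (\<bar>slope k\<bar> * (?a * ?b)) \<le> \<bar>cdet ?Q 0 k\<bar>"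
    proof (cases "?a = 0 \<or> ?b = 0")
      case False
      then have pos: "?a > 0" "?b > 0" by (auto simp: zero_less_measure_iff)
      let ?J = "relevant - (S \<union> {k})"
      let ?m = "\<lambda>j. pmf (p j 1) 1 - pmf (p j 0) 1"
      \<comment> \<open>The sum bounded in \<open>assumption4\<close> for \<open>b = 1\<close> and
        \<open>c = 0\<close>; the set \<open>{1, 0}\<close> in \<open>?G\<close> is written in the
        matching order.\<close>
      let ?t = "\<lambda>x. \<Sum>j\<in>?J. lam j *
          \<bar>cond_exp_event M (\<lambda>\<omega>. cond_mean A p j (X j \<omega>)) (\<lambda>\<omega>. agrees X S x \<omega> \<and> X k \<omega> = 1)
           - cond_exp_event M (\<lambda>\<omega>. cond_mean A p j (X j \<omega>)) (\<lambda>\<omega>. agrees X S x \<omega> \<and> X k \<omega> = 0)\<bar>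
          / (lam k * \<bar>cond_mean A p k 1 - cond_mean A p k 0\<bar>)"
      let ?G = "{x \<in> strings A S. \<forall>e\<in>{1, 0}. Pr (\<lambda>\<omega>. agrees X S x \<omega> \<and> X k \<omega> = e) > 0}"
      have "\<bar>cond_mean A p k 1 - cond_mean A p k 0\<bar> > 0"
        using kl by (auto simp: slope_def cond_mean_eq)
      then have le: "finite_max ?G ?t \<le> 1 - \<Gamma>"
        using Sl S k
        by (intro A4[unfolded assumption4_def, THEN conjunct2, THEN conjunct2, rule_format, of S k 1 0])
          (auto simp: binary)
      have "?t x \<le> finite_max ?G ?t"
        using pos x fin finite_alphabet by (intro finite_max_upper) (auto intro!: finite_strings)
      with le have le: "?t x \<le> 1 - \<Gamma>" by simp
      have sl: "\<bar>slope j\<bar> = lam j * \<bar>?m j\<bar>" if "j \<in> lags d" for j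
        using lam_nonneg[OF that] by (simp add: slope_def abs_mult)
      \<comment> \<open>Multiplication by \<open>?a * ?b\<close> turns the jumps of conditional
        means into covariances and leaves slopes as coefficients.\<close>
      have t_eq: "?t x * (?a * ?b) = (\<Sum>j\<in>?J. \<bar>slope j\<bar> * \<bar>cdet ?Q j k\<bar>) / \<bar>slope k\<bar>"
        unfolding sum_distrib_right sum_divide_distrib
      proof (rule sum.cong[OF refl])
        fix j assume "j \<in> ?J"
        then have j: "j \<in> lags d" by (auto simp: relevant_iff)
        let ?d = "Pr (\<lambda>\<omega>. ?Q \<omega> \<and> X j \<omega> = 1 \<and> X k \<omega> = 1) / ?b
          - Pr (\<lambda>\<omega>. ?Q \<omega> \<and> X j \<omega> = 1 \<and> X k \<omega> = 0) / ?a"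
        have "cond_exp_event M (\<lambda>\<omega>. cond_mean A p j (X j \<omega>)) (\<lambda>\<omega>. ?Q \<omega> \<and> X k \<omega> = 1)
           - cond_exp_event M (\<lambda>\<omega>. cond_mean A p j (X j \<omega>)) (\<lambda>\<omega>. ?Q \<omega> \<and> X k \<omega> = 0) = ?m j * ?d"
          using cond_exp_event_mean[of "\<lambda>\<omega>. ?Q \<omega> \<and> X k \<omega> = 1" j]
            cond_exp_event_mean[of "\<lambda>\<omega>. ?Q \<omega> \<and> X k \<omega> = 0" j] pos
          by (simp add: conj_ac right_diff_distrib)
        moreover have "\<bar>cdet ?Q j k\<bar> = \<bar>?d\<bar> * (?a * ?b)"
          using cdet_eq_cond[OF _ pos, of j] pos by (simp add: abs_mult)
        ultimately show "lam j *
          \<bar>cond_exp_event M (\<lambda>\<omega>. cond_mean A p j (X j \<omega>)) (\<lambda>\<omega>. ?Q \<omega> \<and> X k \<omega> = 1)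
           - cond_exp_event M (\<lambda>\<omega>. cond_mean A p j (X j \<omega>)) (\<lambda>\<omega>. ?Q \<omega> \<and> X k \<omega> = 0)\<bar>
          / (lam k * \<bar>cond_mean A p k 1 - cond_mean A p k 0\<bar>) * (?a * ?b)
          = \<bar>slope j\<bar> * \<bar>cdet ?Q j k\<bar> / \<bar>slope k\<bar>"
          using kl j by (simp add: sl cond_mean_eq abs_mult)
      qed
      have "?t x * (?a * ?b) \<le> (1 - \<Gamma>) * (?a * ?b)"
        using le pos by (intro mult_right_mono) auto
      then have rest: "(\<Sum>j\<in>?J. \<bar>slope j\<bar> * \<bar>cdet ?Q j k\<bar>) \<le> (1 - \<Gamma>) * (\<bar>slope k\<bar> * (?a * ?b))"
        unfolding t_eq using kl(2) by (subst (asm) pos_divide_le_eq) (simp_all only: mult_ac zero_less_abs_iff not_False_eq_True)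
      have J: "?J = relevant - S - {k}" by auto
      have "cdet ?Q 0 k = slope k * cdet ?Q k k + (\<Sum>j\<in>?J. slope j * cdet ?Q j k)"
        unfolding cdet_next_relevant[OF Sl kl(1) x] J
        by (rule sum.remove[OF _ k]) simp
      then have "\<bar>slope k\<bar> * (?a * ?b) = \<bar>cdet ?Q 0 k - (\<Sum>j\<in>?J. slope j * cdet ?Q j k)\<bar>"
        using pos by (simp add: kk abs_mult)
      also have "\<dots> \<le> \<bar>cdet ?Q 0 k\<bar> + \<bar>\<Sum>j\<in>?J. slope j * cdet ?Q j k\<bar>"
        by (rule abs_triangle_ineq4)
      also have "\<dots> \<le> \<bar>cdet ?Q 0 k\<bar> + (\<Sum>j\<in>?J. \<bar>slope j\<bar> * \<bar>cdet ?Q j k\<bar>)"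
        using sum_abs[of "\<lambda>j. slope j * cdet ?Q j k" ?J] by (simp add: abs_mult)
      finally show ?thesis using rest by (simp add: algebra_simps)
    qed auto
    have P: "Pr ?Q = ?a + ?b" by (rule Pr_split) simp
    \<comment> \<open>Division by \<open>Pr ?Q = ?a + ?b\<close> turns the product
      \<open>?a * ?b\<close> into the summand of \<open>expvar\<close>.\<close>
    have "2 * \<Gamma> * (\<bar>slope k\<bar> * parallel_sum ?a ?b) = 2 * (\<Gamma> * (\<bar>slope k\<bar> * (?a * ?b))) / Pr ?Q"
      by (simp add: parallel_sum_def P)
    also have "\<dots> \<le> 2 * \<bar>cdet ?Q 0 k\<bar> / Pr ?Q"
      using key by (intro divide_right_mono) auto
    finally show "2 * \<Gamma> * (\<bar>slope k\<bar> * parallel_sum ?a ?b) \<le> 2 * \<bar>cdet ?Q 0 k\<bar> / Pr ?Q" .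
  qed
  also have "\<dots> = nu_bar M A X k S" by (simp add: nu_bar_eq fin)
  finally show ?thesis .
qed

text \<open>The covariance of \<open>X j\<close> and \<open>X i\<close> is the variance of
  \<open>X j\<close> times a jump that \<open>B j\<close> bounds uniformly over strings. Hence
  \<open>B j\<close> leaves the sum over strings, the variances add up to \<open>expvar j S\<close>,
  and \<open>assumption5\<close> bounds the sum of the \<open>B j\<close>.\<close>

lemma nu_bar_irrelevant_le:
  assumes A5: "assumption5 M A X d lam p \<Gamma>"
    and S: "S \<subseteq> relevant" and i: "i \<in> lags d - relevant"
    and V: "\<And>j. j \<in> relevant - S \<Longrightarrow> \<bar>slope j\<bar> * expvar j S \<le> V" "0 \<le> V"
  shows "nu_bar M A X i S \<le> 2 * \<Gamma> * V"
proof -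
  have Sl: "S \<subseteq> lags d" using S relevant_subset by auto
  have fin: "finite S" using finite_subset[OF Sl] by simp
  have il: "i \<in> lags d - S" using i S by auto
  let ?J = "relevant - S"
  let ?G = "\<lambda>j. {x \<in> strings A S. \<forall>e\<in>{0, 1}. Pr (\<lambda>\<omega>. agrees X S x \<omega> \<and> X j \<omega> = e) > 0}"
  let ?t = "\<lambda>j x. \<bar>\<P>(\<omega> in M. X i \<omega> = 1 \<bar> agrees X S x \<omega> \<and> X j \<omega> = 1)
              - \<P>(\<omega> in M. X i \<omega> = 1 \<bar> agrees X S x \<omega> \<and> X j \<omega> = 0)\<bar>"
  define B where "B j = finite_max (?G j) (?t j)" for j
  have fG: "finite (?G j)" for j
    using fin finite_alphabet by (auto intro!: finite_strings)
  \<comment> \<open>If no string has both values of \<open>X j\<close> possible,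
    \<open>finite_max\<close> takes its default value 0.\<close>
  have B0: "0 \<le> B j" for j
  proof (cases "?G j = {}")
    case False
    obtain x where x: "finite_max (?G j) (?t j) = ?t j x"
      using finite_max_attained[OF fG False, of "?t j"] by blast
    show ?thesis unfolding B_def x by (rule abs_ge_zero)
  qed (simp add: B_def finite_max_def)
  have sumB: "(\<Sum>j\<in>?J. B j) \<le> \<Gamma>"
    using A5 S i unfolding assumption5_def B_def by blast
  have cd: "\<bar>cdet (agrees X S x) j i\<bar>
      \<le> B j * (Pr (\<lambda>\<omega>. agrees X S x \<omega> \<and> X j \<omega> = 0) * Pr (\<lambda>\<omega>. agrees X S x \<omega> \<and> X j \<omega> = 1))"
    if x: "x \<in> strings A S" for x j
  proof -
    let ?Q = "agrees X S x"
    note [measurable] = event_agrees[OF fin, of x]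
    let ?a = "Pr (\<lambda>\<omega>. ?Q \<omega> \<and> X j \<omega> = 0)" and ?b = "Pr (\<lambda>\<omega>. ?Q \<omega> \<and> X j \<omega> = 1)"
    show ?thesis
    proof (cases "?a = 0 \<or> ?b = 0")
      case True
      then show ?thesis using cdet_null[of ?Q j i] by (auto simp: cdet_commute[of _ j i])
    next
      case False
      then have pos: "?a > 0" "?b > 0" by (auto simp: zero_less_measure_iff)
      \<comment> \<open>By symmetry the variance of \<open>X j\<close> is factored out instead of
        that of \<open>X i\<close>, because \<open>assumption5\<close> conditions on
        \<open>X j\<close>.\<close>
      have "\<bar>cdet ?Q j i\<bar> = ?t j x * (?a * ?b)"
        using cdet_eq_cond[OF _ pos, of i] pos
        by (simp add: cdet_commute[of _ j i] abs_mult cond_prob_def conj_ac)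
      also have "\<dots> \<le> B j * (?a * ?b)"
        unfolding B_def using pos x by (intro mult_right_mono finite_max_upper fG) auto
      finally show ?thesis .
    qed
  qed
  have "nu_bar M A X i S = (\<Sum>x\<in>strings A S. 2 * \<bar>cdet (agrees X S x) 0 i\<bar> / Pr (agrees X S x))"
    by (simp add: nu_bar_eq fin)
  also have "\<dots> \<le> (\<Sum>x\<in>strings A S. \<Sum>j\<in>?J. 2 * B j * (\<bar>slope j\<bar> *
      parallel_sum (Pr (\<lambda>\<omega>. agrees X S x \<omega> \<and> X j \<omega> = 0)) (Pr (\<lambda>\<omega>. agrees X S x \<omega> \<and> X j \<omega> = 1))))"
  proof (rule sum_mono)
    fix x assume x: "x \<in> strings A S"
    let ?Q = "agrees X S x"
    let ?a = "\<lambda>j. Pr (\<lambda>\<omega>. ?Q \<omega> \<and> X j \<omega> = 0)" and ?b = "\<lambda>j. Pr (\<lambda>\<omega>. ?Q \<omega> \<and> X j \<omega> = 1)"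
    have "\<bar>cdet ?Q 0 i\<bar> \<le> (\<Sum>j\<in>?J. \<bar>slope j\<bar> * \<bar>cdet ?Q j i\<bar>)"
      unfolding cdet_next_relevant[OF Sl il x]
      using sum_abs[of "\<lambda>j. slope j * cdet ?Q j i" ?J] by (simp add: abs_mult)
    also have "\<dots> \<le> (\<Sum>j\<in>?J. \<bar>slope j\<bar> * (B j * (?a j * ?b j)))"
      using cd[OF x] by (intro sum_mono mult_left_mono) auto
    finally have "2 * \<bar>cdet ?Q 0 i\<bar> / Pr ?Q \<le> 2 * (\<Sum>j\<in>?J. \<bar>slope j\<bar> * (B j * (?a j * ?b j))) / Pr ?Q"
      by (intro divide_right_mono mult_left_mono) auto
    also have "\<dots> = (\<Sum>j\<in>?J. 2 * B j * (\<bar>slope j\<bar> * parallel_sum (?a j) (?b j)))"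
      unfolding sum_distrib_left sum_divide_distrib
    proof (rule sum.cong[OF refl])
      fix j
      have "Pr ?Q = ?a j + ?b j" using event_agrees[OF fin] by (rule Pr_split)
      then show "2 * (\<bar>slope j\<bar> * (B j * (?a j * ?b j))) / Pr ?Q = 2 * B j * (\<bar>slope j\<bar> * parallel_sum (?a j) (?b j))"
        by (simp add: parallel_sum_def)
    qed
    finally show "2 * \<bar>cdet ?Q 0 i\<bar> / Pr ?Q \<le> \<dots>" .
  qed
  also have "\<dots> = (\<Sum>j\<in>?J. 2 * B j * (\<bar>slope j\<bar> * expvar j S))"
    by (subst sum.swap) (simp add: expvar_def sum_distrib_left)
  also have "\<dots> \<le> (\<Sum>j\<in>?J. 2 * B j * V)"
    using V B0 by (intro sum_mono mult_left_mono) auto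
  also have "\<dots> = (\<Sum>j\<in>?J. B j) * (2 * V)"
    by (simp add: sum_distrib_left sum_distrib_right algebra_simps)
  also have "\<dots> \<le> \<Gamma> * (2 * V)"
    using sumB V by (intro mult_right_mono) auto
  finally show ?thesis by simp
qed

text \<open>The same \<open>V\<close> serves both sides: a lag attaining it gives the lower bound
  for relevant lags, and it controls every irrelevant lag from above. By \<open>expvar_ge\<close>,
  \<open>V\<close> is at least \<open>pmin\<^sup>2\<close> times the minimal slope.\<close>

lemma nu_bar_gap:
  assumes A4: "assumption4 M A X d lam p \<Gamma>1" and A5: "assumption5 M A X d lam p \<Gamma>2"
    and le: "\<Gamma>2 \<le> \<Gamma>1" and S: "S \<subset> relevant"
  shows "2 * (\<Gamma>1 - \<Gamma>2) * pmin\<^sup>2 * delta_min A d lam p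
    \<le> finite_max (relevant - S) (\<lambda>j. nu_bar M A X j S)
      - finite_max (lags d - relevant) (\<lambda>j. nu_bar M A X j S)"
proof -
  define V where "V = finite_max (relevant - S) (\<lambda>j. \<bar>slope j\<bar> * expvar j S)"
  obtain k where k: "k \<in> relevant - S" "V = \<bar>slope k\<bar> * expvar k S"
    using finite_max_attained[of "relevant - S" "\<lambda>j. \<bar>slope j\<bar> * expvar j S"] S
    unfolding V_def by auto
  have kl: "k \<in> lags d" and Sl: "S \<subseteq> lags d" using k S relevant_subset by auto
  have "delta_min A d lam p \<le> delta A lam p k"
    unfolding delta_min_def using k by (intro Min_le) auto
  then have "delta_min A d lam p \<le> \<bar>slope k\<bar>" by (simp add: delta_eq kl)
  then have "delta_min A d lam p * pmin\<^sup>2 \<le> \<bar>slope k\<bar> * expvar k S"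
    using k expvar_ge[OF kl Sl] by (intro mult_mono) auto
  then have "2 * (\<Gamma>1 - \<Gamma>2) * (delta_min A d lam p * pmin\<^sup>2) \<le> 2 * (\<Gamma>1 - \<Gamma>2) * V"
    unfolding k(2) using le by (intro mult_left_mono) auto
  moreover have "2 * \<Gamma>1 * V \<le> finite_max (relevant - S) (\<lambda>j. nu_bar M A X j S)"
    using nu_bar_relevant_ge[OF A4 S k(1)] k
      finite_max_upper[of "relevant - S" k "\<lambda>j. nu_bar M A X j S"] by simp
  moreover have "finite_max (lags d - relevant) (\<lambda>j. nu_bar M A X j S) \<le> 2 * \<Gamma>2 * V"
  proof (rule finite_max_least)
    have V0: "0 \<le> V" using expvar_nonneg k by simp
    \<comment> \<open>Covers the case without irrelevant lags, where \<open>finite_max\<close> is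
      0.\<close>
    show "0 \<le> 2 * \<Gamma>2 * V" using A5 V0 by (simp add: assumption5_def)
    fix i assume "i \<in> lags d - relevant"
    then show "nu_bar M A X i S \<le> 2 * \<Gamma>2 * V"
      using S V0 by (intro nu_bar_irrelevant_le[OF A5]) (auto simp: V_def intro!: finite_max_upper)
  qed simp
  ultimately show ?thesis by (simp add: algebra_simps)
qed

text \<open>Until all relevant lags are found, the candidate set stays inside
  \<open>relevant\<close>: the gap exceeds 2\<xi>, while the two compared scores are each off by at
  most \<xi>. A final set with at least \<open>l\<close> elements cannot be a proper subset of
  \<open>relevant\<close>.\<close>

lemma relevant_subset_fs_output:
  assumes A4: "assumption4 M A X d lam p \<Gamma>1" and A5: "assumption5 M A X d lam p \<Gamma>2"
    and le: "\<Gamma>2 \<le> \<Gamma>1" and card: "card relevant \<le> l"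
    and \<xi>: "\<xi> < (\<Gamma>1 - \<Gamma>2) * pmin\<^sup>2 * delta_min A d lam p"
    and good: "\<omega> \<in> good_event M A X d m l \<xi>"
    and out: "fs_output A d m l (\<lambda>t. X t \<omega>) S_hat"
  shows "relevant \<subseteq> S_hat"
proof -
  let ?nu = "nu_hat A d m (\<lambda>t. X t \<omega>)"
  have "relevant \<subseteq> S \<or> S \<subset> relevant" if "fs_reachable (lags d) ?nu l S" for S
    using that
  proof induction
    case start
    then show ?case by auto
  next
    case (step S j)
    show ?case
    proof (cases "relevant \<subseteq> S")
      case False
      then have S: "S \<subset> relevant" using step by auto
      have err: "\<bar>nu_bar M A X i S - ?nu i S\<bar> \<le> \<xi>" if "i \<in> lags d - S" for i
      proof -
        have "\<bar>nu_bar M A X i S - ?nu i S\<bar>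
            \<le> finite_max (lags d - S) (\<lambda>i. \<bar>nu_bar M A X i S - ?nu i S\<bar>)"
          using that by (intro finite_max_upper) auto
        also have "\<dots> \<le> \<xi>"
          using good step(2) S relevant_subset by (auto simp: good_event_def)
        finally show ?thesis .
      qed
      have "j \<in> relevant"
      proof (rule ccontr)
        assume j: "j \<notin> relevant"
        obtain k where k: "k \<in> relevant - S"
          "finite_max (relevant - S) (\<lambda>j. nu_bar M A X j S) = nu_bar M A X k S"
          using finite_max_attained[of "relevant - S" "\<lambda>j. nu_bar M A X j S"] S by auto
        have kl: "k \<in> lags d - S" using k relevant_subset by auto
        have "nu_bar M A X j S \<le> finite_max (lags d - relevant) (\<lambda>j. nu_bar M A X j S)"
          using j step(3) by (intro finite_max_upper) auto
        with nu_bar_gap[OF A4 A5 le S] k(2)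
        have "2 * ((\<Gamma>1 - \<Gamma>2) * pmin\<^sup>2 * delta_min A d lam p) \<le> nu_bar M A X k S - nu_bar M A X j S"
          by linarith
        with \<xi> have "2 * \<xi> < nu_bar M A X k S - nu_bar M A X j S" by linarith
        moreover have "?nu k S \<le> ?nu j S" using step(4) kl by auto
        ultimately show False using err[OF kl] err[OF step(3)] by linarith
      qed
      then show ?thesis using S by auto
    qed auto
  qed
  with out have "relevant \<subseteq> S_hat \<or> S_hat \<subset> relevant" and "l \<le> card S_hat"
    by (auto simp: fs_output_def)
  then show ?thesis
    using psubset_card_mono[OF finite_relevant, of S_hat] card by auto
qed

end

theorem theorem4:
  fixes M :: "'w measure" and A :: "real set" and X :: "int \<Rightarrow> 'w \<Rightarrow> real" and d :: nat
    and lam :: "int \<Rightarrow> real" and p0 :: "real pmf" and p :: "int \<Rightarrow> real \<Rightarrow> real pmf"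
    and \<Gamma>1 \<Gamma>2 :: real
  defines "\<Lambda> \<equiv> relevant_lags A d lam p"
  assumes "mtd_model M A X d lam p0 p"
    and "A = {0, 1}"
    and "assumption4 M A X d lam p \<Gamma>1"
    and "assumption5 M A X d lam p \<Gamma>2"
  shows "(\<Lambda> \<noteq> {} \<and> \<Gamma>2 \<le> \<Gamma>1 \<longrightarrow>
      (MIN S\<in>{S. S \<subset> \<Lambda>}.
         finite_max (\<Lambda> - S) (\<lambda>j. nu_bar M A X j S)
         - finite_max (lags d - \<Lambda>) (\<lambda>j. nu_bar M A X j S))
      \<ge> 2 * (\<Gamma>1 - \<Gamma>2) * (p_min A d lam p0 p)\<^sup>2 * delta_min A d lam p)
    \<and> (\<forall>m l \<xi> \<omega> S_hat.
        \<Gamma>1 > \<Gamma>2 \<and> m > d \<and> card \<Lambda> \<le> l \<and> l \<le> d \<and>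
        0 < \<xi> \<and> \<xi> < (\<Gamma>1 - \<Gamma>2) * (p_min A d lam p0 p)\<^sup>2 * delta_min A d lam p \<and>
        \<omega> \<in> good_event M A X d m l \<xi> \<and> fs_output A d m l (\<lambda>t. X t \<omega>) S_hat
        \<longrightarrow> \<Lambda> \<subseteq> S_hat)"
proof -
  interpret mtd_model M A X d lam p0 p by fact
  interpret binary_mtd M A X d lam p0 p by unfold_locales fact
  have gap: "2 * (\<Gamma>1 - \<Gamma>2) * (p_min A d lam p0 p)\<^sup>2 * delta_min A d lam p
      \<le> (MIN S\<in>{S. S \<subset> \<Lambda>}. finite_max (\<Lambda> - S) (\<lambda>j. nu_bar M A X j S)
         - finite_max (lags d - \<Lambda>) (\<lambda>j. nu_bar M A X j S))"
    if "\<Lambda> \<noteq> {}" "\<Gamma>2 \<le> \<Gamma>1"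
  proof -
    \<comment> \<open>\<open>Min_ge_iff\<close> needs a finite nonempty family; the empty set is a
      proper subset of \<Lambda>.\<close>
    have "finite {S. S \<subset> \<Lambda>}"
      using finite_subset[of "{S. S \<subset> \<Lambda>}" "Pow \<Lambda>"] by (auto simp: \<Lambda>_def)
    moreover have "{S. S \<subset> \<Lambda>} \<noteq> {}" using that by auto
    ultimately show ?thesis
      using nu_bar_gap[OF assms(4,5) that(2)] by (subst Min_ge_iff) (auto simp: \<Lambda>_def)
  qed
  show ?thesis
    unfolding \<Lambda>_def using gap[unfolded \<Lambda>_def] relevant_subset_fs_output[OF assms(4,5)]
    by (blast intro: less_imp_le)
qed

end
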